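(* Let $G$ be non-deterministic and $v\ge0$. For each $n$, let $\gamma^n(v)$ be a semi-directed, non-self-intersecting geodesic from the origin to $(n,\lceil vn\rceil)$, chosen by a fixed deterministic rule. Then almost surely \[\partial^+\Lambda(v)\le\liminf_{n\to\infty}\frac1n\big(U(\gamma^n(v))+R(\gamma^n(v))-D(\gamma^n(v))\big)\] and \[\partial^-\Lambda(v)\ge\limsup_{n\to\infty}\frac1n\big(U(\gamma^n(v))-R(\gamma^n(v))-D(\gamma^n(v))\big).\]
   Context: Model: Let $G$ be a probability measure on $[0,\infty)$. In $\mathbb Z^2$, every vertical edge receives weight $1$ and every horizontal edge (joining $(x,y)$ and $(x+1,y)$) receives an independent random weight with law $G$. A path is a sequence $(z_0,z_1,\dots)$ of points with consecutive points adjacent; its passage time $T(p)$ is the sum of weights over edges $(z_k,z_{k+1})$ of $p$; $T(u,w)=\inf_pT(p)$ over paths from $u$ to $w$, and a path attaining it is a geodesic. A path is semi-directed if $z_{k+1}-z_k\in\{(1,0),(0,1),(0,-1)\}$ for all $k$. For $v\ge 0$, $\Lambda(v)=\lim_n\frac1nT((0,0),(n,\lceil vn\rceil))$ (exists a.s., deterministic, convex); extend to $\mathbb R$ by $\Lambda(-v)=\Lambda(v)$, giving a convex function with one-sided derivatives $\partial^+\Lambda(v)=\lim_{w\searrow v}\frac{\Lambda(w)-\Lambda(v)}{w-v}$ and $\partial^-\Lambda(v)=\lim_{w\nearrow v}\frac{\Lambda(v)-\Lambda(w)}{v-w}$. Pioneer points: for a semi-directed path $p$ from the origin to $(n,m)$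 and $k=0,\dots,n$, let $f_p(k)\in\mathbb Z$ be such that $(k,f_p(k))$ is the first point of $p$ on the line $\{k\}\times\mathbb Z$ (so $f_p(0)=0$), and set $f_p(n+1)=m$. Define $R(p)=|\{k\in\{0,\dots,n\}: f_p(k)=f_p(k+1)\}|$, $U(p)=|\{k\in\{0,\dots,n\}: f_p(k)<f_p(k+1)\}|$, $D(p)=|\{k\in\{0,\dots,n\}: f_p(k)>f_p(k+1)\}|$. *)

theory Defs
  imports "HOL-Probability.Probability"
begin

type_synonym point = "int \<times> int"
type_synonym env = "point \<Rightarrow> real"
  (* \<omega> (x,y) is the weight of the horizontal edge joining (x,y) and (x+1,y) *)

definition env_measure :: "real measure \<Rightarrow> env measure" where
  "env_measure G = PiM UNIV (\<lambda>_. G)"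

definition nondeterministic :: "real measure \<Rightarrow> bool" where
  "nondeterministic G \<longleftrightarrow> (\<forall>a. measure G {a} \<noteq> 1)"

definition adjacent :: "point \<Rightarrow> point \<Rightarrow> bool" where
  "adjacent a b \<longleftrightarrow> \<bar>fst a - fst b\<bar> + \<bar>snd a - snd b\<bar> = 1"

definition edge_weight :: "env \<Rightarrow> point \<Rightarrow> point \<Rightarrow> real" where
  "edge_weight \<omega> a b = (if fst a = fst b then 1 else \<omega> (min (fst a) (fst b), snd a))"

definition is_path :: "point list \<Rightarrow> point \<Rightarrow> point \<Rightarrow> bool" where
  "is_path p u w \<longleftrightarrow> p \<noteq> [] \<and> hd p = u \<and> last p = w \<and>
     (\<forall>i. Suc i < length p \<longrightarrow> adjacent (p ! i) (p ! Suc i))"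

definition passage :: "env \<Rightarrow> point list \<Rightarrow> real" where
  "passage \<omega> p = (\<Sum>i<length p - 1. edge_weight \<omega> (p ! i) (p ! Suc i))"

definition T :: "env \<Rightarrow> point \<Rightarrow> point \<Rightarrow> real" where
  "T \<omega> u w = (INF p \<in> {p. is_path p u w}. passage \<omega> p)"

definition geodesic :: "env \<Rightarrow> point list \<Rightarrow> point \<Rightarrow> point \<Rightarrow> bool" where
  "geodesic \<omega> p u w \<longleftrightarrow> is_path p u w \<and> passage \<omega> p = T \<omega> u w"

definition semi_directed :: "point list \<Rightarrow> bool" where
  "semi_directed p \<longleftrightarrow> (\<forall>i. Suc i < length p \<longrightarrow>
     (fst (p ! Suc i) - fst (p ! i), snd (p ! Suc i) - snd (p ! i)) \<in> {(1,0), (0,1), (0,-1)})"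

definition Lambda0 :: "real measure \<Rightarrow> real \<Rightarrow> real" where
  "Lambda0 G v = (THE c. AE \<omega> in env_measure G.
      (\<lambda>n. T \<omega> (0,0) (int n, \<lceil>v * real n\<rceil>) / real n) \<longlonglongrightarrow> c)"

definition Lambda :: "real measure \<Rightarrow> real \<Rightarrow> real" where
  "Lambda G v = Lambda0 G \<bar>v\<bar>"

definition dplus :: "(real \<Rightarrow> real) \<Rightarrow> real \<Rightarrow> real" where
  "dplus f v = Lim (at_right v) (\<lambda>w. (f w - f v) / (w - v))"

definition dminus :: "(real \<Rightarrow> real) \<Rightarrow> real \<Rightarrow> real" where
  "dminus f v = Lim (at_left v) (\<lambda>w. (f v - f w) / (v - w))"

definition fpio :: "point list \<Rightarrow> nat \<Rightarrow> int \<Rightarrow> nat \<Rightarrow> int" where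
  "fpio p n m k = (if k = Suc n then m
     else snd (p ! (LEAST i. i < length p \<and> fst (p ! i) = int k)))"

definition Rcount :: "point list \<Rightarrow> nat \<Rightarrow> int \<Rightarrow> nat" where
  "Rcount p n m = card {k \<in> {0..n}. fpio p n m k = fpio p n m (Suc k)}"

definition Ucount :: "point list \<Rightarrow> nat \<Rightarrow> int \<Rightarrow> nat" where
  "Ucount p n m = card {k \<in> {0..n}. fpio p n m k < fpio p n m (Suc k)}"

definition Dcount :: "point list \<Rightarrow> nat \<Rightarrow> int \<Rightarrow> nat" where
  "Dcount p n m = card {k \<in> {0..n}. fpio p n m k > fpio p n m (Suc k)}"

definition good_geod :: "env \<Rightarrow> point list \<Rightarrow> nat \<Rightarrow> int \<Rightarrow> bool" where
  "good_geod \<omega> p n m \<longleftrightarrow> semi_directed p \<and> distinct p \<and> geodesic \<omega> p (0,0) (int n, m)"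

end

theory Submission
  imports Defs "HOL-Real_Asymp.Real_Asymp"
begin

text \<open>
  Since vertical edges have weight 1 and horizontal weights are nonnegative, backward steps never
  pay off, so the passage time is given by a recursion over columns and depends on the first \<open>n\<close>
  columns only. Subadditivity with independent increments then gives the limit \<open>\<Lambda>\<close>: means converge
  by Fekete's lemma, second moments along \<open>n 2\<^sup>j\<close> give summable variances, and monotonicity in the
  number of columns fills the gaps. Taking means, \<open>\<Lambda>\<close> is convex and Lipschitz.

  For the derivative, fix \<open>q\<close> and \<open>s < q\<close> and move column \<open>k\<close> of the environment upwards by the number
  of \<open>i \<le> k\<close> with \<open>i \<equiv> s\<close> modulo \<open>q\<close>. The new environment has the same law, and the geodesic moved
  along with it ends at slope about \<open>v + 1/q\<close>. Only its vertical steps change cost: at each jump by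
  \<open>+1\<close> if the step is upwards or flat, by \<open>-1\<close> if it is downwards. Summing over the
  phases \<open>s\<close> yields \<open>q (\<Lambda>(v + 1/q) - \<Lambda>(v)) \<le> liminf (U + R - D)/n\<close>, and \<open>q \<rightarrow> \<infinity>\<close> gives the first
  claim. Moving downwards gives the second.
\<close>

section \<open>Semi-directed passage times\<close>

text \<open>The absolute value keeps the infimum bounded below for every environment; almost surely it
  changes nothing.\<close>

fun V :: "env \<Rightarrow> nat \<Rightarrow> int \<Rightarrow> real" where
  "V \<omega> 0 m = real_of_int \<bar>m\<bar>"
| "V \<omega> (Suc n) m = (INF y. V \<omega> n y + \<bar>\<omega> (int n, y)\<bar> + real_of_int \<bar>m - y\<bar>)"

lemma V_nonneg: "0 \<le> V \<omega> n m"
proof (induction n arbitrary: m)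
  case (Suc n)
  then show ?case by (auto intro!: cINF_greatest add_nonneg_nonneg)
qed simp

lemma V_bdd_below: "bdd_below (range (\<lambda>y. V \<omega> n y + \<bar>\<omega> (int n, y)\<bar> + real_of_int \<bar>m - y\<bar>))"
  by (rule bdd_belowI[of _ 0]) (auto intro!: add_nonneg_nonneg V_nonneg)

lemma V_Suc_le: "V \<omega> (Suc n) m \<le> V \<omega> n y + \<bar>\<omega> (int n, y)\<bar> + real_of_int \<bar>m - y\<bar>"
  using cINF_lower[OF V_bdd_below[of \<omega> n m] UNIV_I, of y] by (simp add: V.simps(2))

lemma V_Suc_ge:
  assumes "\<And>y. c \<le> V \<omega> n y + \<bar>\<omega> (int n, y)\<bar> + real_of_int \<bar>m - y\<bar>"
  shows "c \<le> V \<omega> (Suc n) m"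
  using assms by (auto intro!: cINF_greatest)

declare V.simps(2) [simp del]

lemma V_lipschitz: "V \<omega> n m \<le> V \<omega> n m' + real_of_int \<bar>m - m'\<bar>"
proof (cases n)
  case (Suc k)
  have "V \<omega> (Suc k) m - real_of_int \<bar>m - m'\<bar> \<le> V \<omega> (Suc k) m'"
  proof (rule V_Suc_ge)
    fix y
    show "V \<omega> (Suc k) m - real_of_int \<bar>m - m'\<bar> \<le> V \<omega> k y + \<bar>\<omega> (int k, y)\<bar> + real_of_int \<bar>m' - y\<bar>"
      using V_Suc_le[of \<omega> k m y] by linarith
  qed
  then show ?thesis using Suc by simp
qed simp

text \<open>Moving from height \<open>y\<close> to \<open>m\<close> in the extra column costs |m -
  y|, which by \<open>V_lipschitz\<close> already pays for the change of height. This is what makes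
  backward steps useless.\<close>

lemma V_mono_Suc: "V \<omega> n m \<le> V \<omega> (Suc n) m"
proof (rule V_Suc_ge)
  fix y
  show "V \<omega> n m \<le> V \<omega> n y + \<bar>\<omega> (int n, y)\<bar> + real_of_int \<bar>m - y\<bar>"
    using V_lipschitz[of \<omega> n m y] by linarith
qed

lemma V_mono: "n \<le> n' \<Longrightarrow> V \<omega> n m \<le> V \<omega> n' m"
  by (rule lift_Suc_mono_le[of "\<lambda>n. V \<omega> n m"]) (simp_all add: V_mono_Suc)

text \<open>Concatenation: an optimal route to \<open>(n, m)\<close> is continued by an optimal
  route in the environment re-rooted there. The induction extends the second route column by column;
  its base case is the Lipschitz bound, since crossing no column costs |m'|.\<close>

lemma V_subadditive:
  "V \<omega> (n + k) (m + m') \<le> V \<omega> n m + V (\<lambda>z. \<omega> (fst z + int n, snd z + m)) k m'"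
proof (induction k arbitrary: m')
  case 0
  then show ?case using V_lipschitz[of \<omega> n "m + m'" m] by simp
next
  case (Suc k)
  let ?\<omega> = "\<lambda>z. \<omega> (fst z + int n, snd z + m)"
  have "V \<omega> (Suc (n + k)) (m + m') - V \<omega> n m \<le> V ?\<omega> (Suc k) m'"
  proof (rule V_Suc_ge)
    fix y
    show "V \<omega> (Suc (n + k)) (m + m') - V \<omega> n m
        \<le> V ?\<omega> k y + \<bar>?\<omega> (int k, y)\<bar> + real_of_int \<bar>m' - y\<bar>"
      using V_Suc_le[of \<omega> "n + k" "m + m'" "m + y"] Suc[of y] by (simp add: add.commute)
  qed
  then show ?case by simp
qed

lemma V_reflect_le: "V \<omega> n m \<le> V (\<lambda>z. \<omega> (fst z, - snd z)) n (- m)"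
proof (induction n arbitrary: m)
  case (Suc n)
  show ?case
  proof (rule V_Suc_ge)
    fix y
    show "V \<omega> (Suc n) m \<le> V (\<lambda>z. \<omega> (fst z, - snd z)) n y
        + \<bar>\<omega> (fst (int n, y), - snd (int n, y))\<bar> + real_of_int \<bar>- m - y\<bar>"
      using V_Suc_le[of \<omega> n m "- y"] Suc[of "- y"] by (simp add: abs_if split: if_splits)
  qed
qed simp

lemma V_reflect: "V (\<lambda>z. \<omega> (fst z, - snd z)) n m = V \<omega> n (- m)"
  using V_reflect_le[of \<omega> n "- m"] V_reflect_le[of "\<lambda>z. \<omega> (fst z, - snd z)" n m] by simp

text \<open>Every height profile is a competitor. The convention is that \<open>h (Suc k)\<close>
  for \<open>k < n\<close> is the height at which the edge leaving column \<open>k\<close> is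
  crossed and \<open>h (Suc n)\<close> is the final height, as for pioneer points.\<close>

lemma V_le_cost:
  assumes "h 0 = 0"
  shows "V \<omega> n (h (Suc n)) \<le> (\<Sum>k<n. \<bar>\<omega> (int k, h (Suc k))\<bar>)
           + (\<Sum>k\<le>n. real_of_int \<bar>h (Suc k) - h k\<bar>)"
proof (induction n)
  case (Suc n)
  then show ?case using V_Suc_le[of \<omega> n "h (Suc (Suc n))" "h (Suc n)"] by simp
qed (use assms in simp)

text \<open>The vertical term makes the costs coercive: only finitely many \<open>y\<close> do as
  well as \<open>y = 0\<close>, so the infimum is a minimum. Existence of geodesics rests on
  this.\<close>

lemma V_Suc_attained:
  "\<exists>y. V \<omega> (Suc n) m = V \<omega> n y + \<bar>\<omega> (int n, y)\<bar> + real_of_int \<bar>m - y\<bar>"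
proof -
  define g where "g y = V \<omega> n y + \<bar>\<omega> (int n, y)\<bar> + real_of_int \<bar>m - y\<bar>" for y
  define A where "A = {y. g y \<le> g 0}"
  have "\<bar>m - y\<bar> \<le> \<lceil>g 0\<rceil>" if "y \<in> A" for y
  proof -
    have "real_of_int \<bar>m - y\<bar> \<le> g y" using V_nonneg[of \<omega> n y] by (simp add: g_def)
    also have "g y \<le> g 0" using that by (simp add: A_def)
    finally show ?thesis by (metis ceiling_mono ceiling_of_int)
  qed
  then have "A \<subseteq> {m - \<lceil>g 0\<rceil> .. m + \<lceil>g 0\<rceil>}" by force
  then have fin: "finite A" using finite_subset by blast
  have "0 \<in> A" by (simp add: A_def)
  then obtain y where y: "y \<in> A" "\<And>z. z \<in> A \<Longrightarrow> g y \<le> g z"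
    using fin by (metis arg_min_if_finite(1) arg_min_least empty_iff)
  have "g y \<le> g z" for z using y \<open>0 \<in> A\<close> by (cases "z \<in> A") (force simp: A_def)+
  then have "g y \<le> V \<omega> (Suc n) m" by (intro V_Suc_ge) (simp add: g_def)
  with V_Suc_le[of \<omega> n m y] show ?thesis by (intro exI[of _ y]) (simp add: g_def)
qed

text \<open>Only coordinates in columns left of \<open>n\<close> are required to be measurable, so
  the lemma also applies on a product over part of the lattice; the independence argument uses it
  there. The infimum stays measurable because it runs over countably many heights.\<close>

lemma V_measurable:
  assumes "\<And>k y. k < n \<Longrightarrow> (\<lambda>x. f x (int k, y)) \<in> borel_measurable N"
  shows "(\<lambda>x. V (f x) n m) \<in> borel_measurable N"
  using assms
proof (induction n arbitrary: m)
  case (Suc n)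
  have "(\<lambda>x. INF y. V (f x) n y + \<bar>f x (int n, y)\<bar> + real_of_int \<bar>m - y\<bar>) \<in> borel_measurable N"
  proof (rule borel_measurable_cINF)
    show "(\<lambda>x. V (f x) n y + \<bar>f x (int n, y)\<bar> + real_of_int \<bar>m - y\<bar>) \<in> borel_measurable N" for y
      using Suc.IH[of y] Suc.prems by measurable
  qed (simp_all only: V_bdd_below countableI_type)
  then show ?case by (simp add: V.simps(2))
qed simp

lemma V_cong:
  assumes "\<And>k y. k < n \<Longrightarrow> \<omega> (int k, y) = \<omega>' (int k, y)"
  shows "V \<omega> n m = V \<omega>' n m"
  using assms
proof (induction n arbitrary: m)
  case (Suc n)
  then have "V \<omega> n = V \<omega>' n" "\<And>y. \<omega> (int n, y) = \<omega>' (int n, y)" by (auto intro!: ext)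
  then show ?case by (simp add: V.simps(2))
qed simp

section \<open>Paths\<close>

lemma is_path_single: "is_path [z] u w \<longleftrightarrow> z = u \<and> z = w"
  by (auto simp: is_path_def)

text \<open>Paths are grown at their right end throughout; this is the common source of the
  recursions for \<open>is_path\<close> and \<open>semi_directed\<close>.\<close>

lemma consecutive_snoc:
  assumes "p \<noteq> []"
  shows "(\<forall>i. Suc i < length (p @ [z]) \<longrightarrow> P ((p @ [z]) ! i) ((p @ [z]) ! Suc i))
     \<longleftrightarrow> (\<forall>i. Suc i < length p \<longrightarrow> P (p ! i) (p ! Suc i)) \<and> P (last p) z" (is "?L \<longleftrightarrow> ?R")
proof
  assume L: ?L
  have "P (p ! i) (p ! Suc i)" if "Suc i < length p" for i
    using L[rule_format, of i] that by (simp add: nth_append)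
  moreover have "P (last p) z"
    using L[rule_format, of "length p - 1"] assms by (simp add: nth_append last_conv_nth)
  ultimately show ?R by blast
next
  assume R: ?R
  show ?L
  proof (intro allI impI)
    fix i assume "Suc i < length (p @ [z])"
    then consider "Suc i < length p" | "i = length p - 1" by fastforce
    then show "P ((p @ [z]) ! i) ((p @ [z]) ! Suc i)"
      using R assms by cases (auto simp: nth_append last_conv_nth)
  qed
qed

lemma is_path_snoc:
  assumes "p \<noteq> []"
  shows "is_path (p @ [z]) u w \<longleftrightarrow> is_path p u (last p) \<and> adjacent (last p) z \<and> w = z"
  unfolding is_path_def consecutive_snoc[OF assms] using assms by auto

lemma semi_directed_snoc:
  assumes "p \<noteq> []"
  shows "semi_directed (p @ [z]) \<longleftrightarrow> semi_directed p \<and>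
    (fst z - fst (last p), snd z - snd (last p)) \<in> {(1,0), (0,1), (0,-1)}"
  unfolding semi_directed_def
  using consecutive_snoc[OF assms, where P = "\<lambda>a b. (fst b - fst a, snd b - snd a) \<in> {(1,0), (0,1), (0,-1)}"]
  by simp

lemma passage_single: "passage \<omega> [z] = 0"
  by (simp add: passage_def)

lemma passage_snoc:
  assumes "p \<noteq> []"
  shows "passage \<omega> (p @ [z]) = passage \<omega> p + edge_weight \<omega> (last p) z"
proof -
  have "length p = Suc (length p - 1)" using assms by simp
  then have "passage \<omega> (p @ [z]) = (\<Sum>i<length p - 1. edge_weight \<omega> ((p @ [z]) ! i) ((p @ [z]) ! Suc i))
      + edge_weight \<omega> ((p @ [z]) ! (length p - 1)) ((p @ [z]) ! Suc (length p - 1))"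
    unfolding passage_def by (metis (no_types, lifting) diff_Suc_1 length_append_singleton sum.lessThan_Suc)
  also have "(\<Sum>i<length p - 1. edge_weight \<omega> ((p @ [z]) ! i) ((p @ [z]) ! Suc i)) = passage \<omega> p"
    unfolding passage_def by (intro sum.cong) (auto simp: nth_append)
  finally show ?thesis using assms by (simp add: nth_append last_conv_nth)
qed

text \<open>A lower potential: \<^term>\<open>V \<omega> (nat x) y\<close> grows along each edge by at most the weight of
  the edge, so backward horizontal steps are never profitable.\<close>

lemma V_le_passage:
  assumes nonneg: "\<forall>z. 0 \<le> \<omega> z" and "is_path p (0, 0) w"
  shows "V \<omega> (nat (fst w)) (snd w) \<le> passage \<omega> p"
  using assms(2)
proof (induction p arbitrary: w rule: rev_induct)
  case (snoc z p)
  show ?case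
  proof (cases "p = []")
    case True
    then show ?thesis using snoc.prems by (auto simp: is_path_single passage_single)
  next
    case False
    let ?a = "last p"
    have p: "is_path p (0, 0) ?a" "adjacent ?a z" "w = z"
      using snoc.prems False by (auto simp: is_path_snoc)
    obtain x y x' y' where xy: "?a = (x, y)" "z = (x', y')" by (metis surj_pair)
    have IH: "V \<omega> (nat x) y \<le> passage \<omega> p" using snoc.IH[OF p(1)] xy by simp
    have "\<bar>x - x'\<bar> + \<bar>y - y'\<bar> = 1" using p(2) xy by (simp add: adjacent_def)
    then consider "x' = x" "\<bar>y' - y\<bar> = 1" | "y' = y" "x' = x + 1" | "y' = y" "x' = x - 1"
      by linarith
    then have "V \<omega> (nat x') y' \<le> V \<omega> (nat x) y + edge_weight \<omega> ?a z"
    proof cases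
      case 1
      then show ?thesis using V_lipschitz[of \<omega> "nat x" y' y] xy by (simp add: edge_weight_def)
    next
      case 2
      show ?thesis
      \<comment> \<open>To the left of the origin \<open>nat\<close> sends both columns to 0, so the
        potential does not change and a nonnegative weight suffices.\<close>
      proof (cases "x \<ge> 0")
        case True
        then have "nat x' = Suc (nat x)" using 2 by simp
        then show ?thesis using V_Suc_le[of \<omega> "nat x" y y] 2 xy True nonneg[rule_format, of "(x, y)"]
          by (simp add: edge_weight_def)
      qed (use 2 xy nonneg in \<open>simp add: edge_weight_def\<close>)
    next
      case 3
      then show ?thesis using V_mono[of "nat x'" "nat x" \<omega> y] xy nonneg[rule_format, of "(x', y)"] nat_mono[of "x - 1" x]
        by (simp add: edge_weight_def min_def)
    qed
    then show ?thesis using IH False p(3) xy by (simp add: passage_snoc)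
  qed
qed (simp add: is_path_def)

section \<open>Self-avoiding semi-directed minimizers\<close>

definition column_path :: "env \<Rightarrow> point list \<Rightarrow> nat \<Rightarrow> int \<Rightarrow> real \<Rightarrow> bool" where
  "column_path \<omega> p n m c \<longleftrightarrow> semi_directed p \<and> distinct p \<and> is_path p (0, 0) (int n, m)
     \<and> (\<forall>z\<in>set p. fst z \<le> int n) \<and> passage \<omega> p = c"

text \<open>The invariant is that everything beyond the endpoint in direction \<sigma> is unvisited,
  so a vertical extension by unit steps stays self-avoiding.\<close>

lemma column_path_vertical:
  assumes "column_path \<omega> p n m c" and "\<sigma> = 1 \<or> \<sigma> = -1"
    and "\<And>j. j > 0 \<Longrightarrow> (int n, m + \<sigma> * j) \<notin> set p"
  shows "\<exists>p'. column_path \<omega> p' n (m + \<sigma> * int d) (c + real d)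
      \<and> (\<forall>j>0. (int n, m + \<sigma> * int d + \<sigma> * j) \<notin> set p')"
proof (induction d)
  case 0
  show ?case using assms(1,3) by (intro exI[of _ p]) simp
next
  case (Suc d)
  then obtain p' where p': "column_path \<omega> p' n (m + \<sigma> * int d) (c + real d)"
    "\<forall>j>0. (int n, m + \<sigma> * int d + \<sigma> * j) \<notin> set p'" by blast
  then have ne: "p' \<noteq> []" and la: "last p' = (int n, m + \<sigma> * int d)"
    by (auto simp: column_path_def is_path_def)
  let ?z = "(int n, m + \<sigma> * int d + \<sigma> * 1)"
  have "?z \<notin> set p'" using p'(2)[rule_format, of 1] by simp
  then have "column_path \<omega> (p' @ [?z]) n (m + \<sigma> * int (Suc d)) (c + real (Suc d))"
    using p'(1) ne la assms(2)
    by (auto simp: column_path_def is_path_snoc semi_directed_snoc passage_snoc adjacent_def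
        edge_weight_def algebra_simps)
  moreover have "(int n, m + \<sigma> * int (Suc d) + \<sigma> * j) \<notin> set (p' @ [?z])" if "j > 0" for j
    using p'(2)[rule_format, of "1 + j"] that assms(2) by (auto simp: algebra_simps)
  ultimately show ?case by blast
qed

lemma column_path_to_height:
  assumes "column_path \<omega> p n y c" and "\<And>j. (int n, j) \<in> set p \<Longrightarrow> j = y"
  shows "\<exists>p'. column_path \<omega> p' n m (c + real_of_int \<bar>m - y\<bar>)"
proof -
  define \<sigma> :: int where "\<sigma> = (if m \<ge> y then 1 else -1)"
  define d where "d = nat \<bar>m - y\<bar>"
  have \<sigma>: "\<sigma> = 1 \<or> \<sigma> = -1" by (simp add: \<sigma>_def)
  have "\<And>j. j > 0 \<Longrightarrow> (int n, y + \<sigma> * j) \<notin> set p"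
  proof
    fix j :: int assume "j > 0" "(int n, y + \<sigma> * j) \<in> set p"
    then show False using assms(2)[of "y + \<sigma> * j"] \<sigma> by auto
  qed
  then obtain p' where "column_path \<omega> p' n (y + \<sigma> * int d) (c + real d)"
    using column_path_vertical[OF assms(1) \<sigma>, of d] by blast
  moreover have "y + \<sigma> * int d = m" "real d = real_of_int \<bar>m - y\<bar>" by (auto simp: \<sigma>_def d_def)
  ultimately show ?thesis by auto
qed

lemma column_path_exists:
  assumes nonneg: "\<forall>z. 0 \<le> \<omega> z"
  shows "\<exists>p. column_path \<omega> p n m (V \<omega> n m)"
proof (induction n arbitrary: m)
  case 0
  have "column_path \<omega> [(0, 0)] 0 0 0"
    by (simp add: column_path_def is_path_single passage_single semi_directed_def)
  from column_path_to_height[OF this, of m] show ?case by simp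
next
  case (Suc n)
  obtain y where y: "V \<omega> (Suc n) m = V \<omega> n y + \<bar>\<omega> (int n, y)\<bar> + real_of_int \<bar>m - y\<bar>"
    using V_Suc_attained by blast
  obtain p where p: "column_path \<omega> p n y (V \<omega> n y)" using Suc by blast
  then have ne: "p \<noteq> []" and la: "last p = (int n, y)"
    by (auto simp: column_path_def is_path_def)
  let ?z = "(int (Suc n), y)"
  \<comment> \<open>\<open>column_path\<close> confines the points to columns up to
    \<open>n\<close>; hence the appended point is new, and it is the only point in column
    \<open>n + 1\<close>, which leaves both vertical directions free.\<close>
  have le: "\<And>j. (int (Suc n), j) \<notin> set p" using p by (force simp: column_path_def)
  have "column_path \<omega> (p @ [?z]) (Suc n) y (V \<omega> n y + \<bar>\<omega> (int n, y)\<bar>)"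
    using p ne la le[of y] nonneg[rule_format, of "(int n, y)"]
    by (auto simp: column_path_def is_path_snoc semi_directed_snoc passage_snoc adjacent_def
        edge_weight_def)
  from column_path_to_height[OF this, of m] show ?case using le y by auto
qed

text \<open>The potential bounds all paths from below, also those with backward steps, and a column
  path attains the bound.\<close>

lemma T_eq_V:
  assumes nonneg: "\<forall>z. 0 \<le> \<omega> z"
  shows "T \<omega> (0, 0) (int n, m) = V \<omega> n m"
proof -
  obtain p where p: "column_path \<omega> p n m (V \<omega> n m)" using column_path_exists[OF assms] by blast
  have lower: "V \<omega> n m \<le> passage \<omega> q" if "is_path q (0, 0) (int n, m)" for q
    using V_le_passage[OF nonneg that] by simp
  have p': "is_path p (0, 0) (int n, m)" "passage \<omega> p = V \<omega> n m"
    using p by (auto simp: column_path_def)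
  show ?thesis unfolding T_def
  proof (rule antisym)
    show "(INF p \<in> {p. is_path p (0, 0) (int n, m)}. passage \<omega> p) \<le> V \<omega> n m"
      using p' lower by (intro cINF_lower2[of _ _ p] bdd_belowI2[of _ "V \<omega> n m"]) auto
    show "V \<omega> n m \<le> (INF p \<in> {p. is_path p (0, 0) (int n, m)}. passage \<omega> p)"
      using p' lower by (intro cINF_greatest) auto
  qed
qed

lemma good_geod_exists:
  assumes nonneg: "\<forall>z. 0 \<le> \<omega> z"
  shows "\<exists>p. good_geod \<omega> p n m"
  using column_path_exists[OF assms, of n m] T_eq_V[OF assms, of n m]
  by (auto simp: column_path_def good_geod_def geodesic_def)

section \<open>Pioneer heights and the cost of a semi-directed path\<close>

definition first_height :: "point list \<Rightarrow> nat \<Rightarrow> int" where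
  "first_height p k = snd (p ! (LEAST i. i < length p \<and> fst (p ! i) = int k))"

lemma first_height_snoc_old:
  assumes "i < length p" "fst (p ! i) = int k"
  shows "first_height (p @ [z]) k = first_height p k"
proof -
  let ?P = "\<lambda>i. i < length p \<and> fst (p ! i) = int k"
  have L: "?P (Least ?P)" by (rule LeastI[of ?P i]) (use assms in simp)
  have "(LEAST i. i < length (p @ [z]) \<and> fst ((p @ [z]) ! i) = int k) = Least ?P"
  proof (rule Least_equality)
    show "Least ?P < length (p @ [z]) \<and> fst ((p @ [z]) ! Least ?P) = int k"
      using L by (simp add: nth_append)
    fix j assume j: "j < length (p @ [z]) \<and> fst ((p @ [z]) ! j) = int k"
    show "Least ?P \<le> j"
    proof (cases "j < length p")
      case True
      then show ?thesis using j by (intro Least_le) (simp add: nth_append)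
    qed (use L in simp)
  qed
  then show ?thesis using L by (simp add: first_height_def nth_append)
qed

lemma first_height_snoc_new:
  assumes "\<And>i. i < length p \<Longrightarrow> fst (p ! i) \<noteq> int k" "fst z = int k"
  shows "first_height (p @ [z]) k = snd z"
proof -
  have "(LEAST i. i < length (p @ [z]) \<and> fst ((p @ [z]) ! i) = int k) = length p"
  proof (rule Least_equality)
    fix j assume "j < length (p @ [z]) \<and> fst ((p @ [z]) ! j) = int k"
    then show "length p \<le> j" using assms(1)[of j] by (auto simp: nth_append split: if_splits)
  qed (use assms in simp)
  then show ?thesis by (simp add: first_height_def)
qed

text \<open>A semi-directed path enters column \<open>k + 1\<close> along a single horizontal edge,
  at the height of its first point there; its vertical steps in column \<open>k\<close> number at
  least the difference of the two first heights. \<open>first_height\<close> avoids the endpoint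
  parameters of \<open>fpio\<close>, so that the induction can cut the path anywhere.\<close>

lemma semi_directed_passage_ge:
  assumes "is_path p (0, 0) w" "semi_directed p"
  shows "\<exists>n. fst w = int n \<and> (\<forall>k\<le>n. \<exists>i<length p. fst (p ! i) = int k)
    \<and> (\<forall>i<length p. fst (p ! i) \<le> int n) \<and> first_height p 0 = 0
    \<and> (\<Sum>k<n. \<omega> (int k, first_height p (Suc k)))
      + (\<Sum>k<n. real_of_int \<bar>first_height p (Suc k) - first_height p k\<bar>)
      + real_of_int \<bar>snd w - first_height p n\<bar> \<le> passage \<omega> p"
  using assms
proof (induction p arbitrary: w rule: rev_induct)
  case (snoc z p)
  show ?case
  proof (cases "p = []")
    case True
    then have "w = (0, 0)" "z = (0, 0)" using snoc.prems by (auto simp: is_path_single)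
    moreover have "first_height ([] @ [(0, 0)]) 0 = snd (0 :: int, 0 :: int)"
      by (rule first_height_snoc_new) auto
    ultimately show ?thesis using True by (intro exI[of _ 0]) (simp add: passage_single)
  next
    case False
    let ?a = "last p"
    have p: "is_path p (0, 0) ?a" "w = z" "semi_directed p"
      and st: "(fst z - fst ?a, snd z - snd ?a) \<in> {(1,0), (0,1), (0,-1)}"
      using snoc.prems False by (auto simp: is_path_snoc semi_directed_snoc)
    obtain n where n: "fst ?a = int n" "\<And>k. k \<le> n \<Longrightarrow> \<exists>i<length p. fst (p ! i) = int k"
      "\<And>i. i < length p \<Longrightarrow> fst (p ! i) \<le> int n" "first_height p 0 = 0"
      "(\<Sum>k<n. \<omega> (int k, first_height p (Suc k)))
      + (\<Sum>k<n. real_of_int \<bar>first_height p (Suc k) - first_height p k\<bar>)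
      + real_of_int \<bar>snd ?a - first_height p n\<bar> \<le> passage \<omega> p"
      using snoc.IH[OF p(1,3)] by blast
    let ?q = "p @ [z]"
    have old: "first_height ?q k = first_height p k" if "k \<le> n" for k
      using n(2)[OF that] first_height_snoc_old by blast
    have s1: "(\<Sum>k<n. \<omega> (int k, first_height ?q (Suc k))) = (\<Sum>k<n. \<omega> (int k, first_height p (Suc k)))"
      and s2: "(\<Sum>k<n. real_of_int \<bar>first_height ?q (Suc k) - first_height ?q k\<bar>)
         = (\<Sum>k<n. real_of_int \<bar>first_height p (Suc k) - first_height p k\<bar>)"
      using old by (auto intro!: sum.cong)
    have vis: "\<exists>i<length ?q. fst (?q ! i) = int k" if "k \<le> n" for k
      using n(2)[OF that] by (force simp: nth_append)
    \<comment> \<open>A vertical step changes only the last, unfinished term, by at most 1. A step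
      to the right completes the term of column \<open>n\<close>, and its endpoint becomes the first
      point of the next column, where the unfinished term is 0.\<close>
    consider "fst z = int n" "\<bar>snd z - snd ?a\<bar> = 1" | "fst z = int (Suc n)" "snd z = snd ?a"
      using st n(1) by auto
    then show ?thesis
    proof cases
      case 1
      have le: "\<forall>i<length ?q. fst (?q ! i) \<le> int n"
        using n(3) 1 by (auto simp: nth_append less_Suc_eq)
      have "edge_weight \<omega> ?a z = 1" using 1 n(1) by (simp add: edge_weight_def)
      moreover have "real_of_int \<bar>snd z - first_height p n\<bar> \<le> real_of_int \<bar>snd ?a - first_height p n\<bar> + 1"
        using 1 by linarith
      ultimately have "(\<Sum>k<n. \<omega> (int k, first_height ?q (Suc k)))
      + (\<Sum>k<n. real_of_int \<bar>first_height ?q (Suc k) - first_height ?q k\<bar>)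
      + real_of_int \<bar>snd w - first_height ?q n\<bar> \<le> passage \<omega> ?q"
        using n(5) s1 s2 old[of n] p(2) False by (simp add: passage_snoc)
      then show ?thesis using 1 p(2) vis le old[of 0] n(4) by (intro exI[of _ n]) simp
    next
      case 2
      have le: "\<forall>i<length ?q. fst (?q ! i) \<le> int (Suc n)"
        using 2 by (auto simp: nth_append less_Suc_eq dest!: n(3))
      have new: "first_height ?q (Suc n) = snd z"
        using n(3) 2 by (intro first_height_snoc_new) force+
      have "edge_weight \<omega> ?a z = \<omega> (int n, snd z)" using 2 n(1) by (simp add: edge_weight_def)
      then have "(\<Sum>k<Suc n. \<omega> (int k, first_height ?q (Suc k)))
      + (\<Sum>k<Suc n. real_of_int \<bar>first_height ?q (Suc k) - first_height ?q k\<bar>)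
      + real_of_int \<bar>snd w - first_height ?q (Suc n)\<bar> \<le> passage \<omega> ?q"
        using n(5) s1 s2 old[of n] p(2) False new 2 by (simp add: passage_snoc)
      moreover have "\<exists>i<length ?q. fst (?q ! i) = int k" if "k \<le> Suc n" for k
      proof (cases "k = Suc n")
        case True
        then show ?thesis using 2 by (intro exI[of _ "length p"]) simp
      qed (use vis that in simp)
      ultimately show ?thesis using 2 p(2) le old[of 0] n(4) by (intro exI[of _ "Suc n"]) simp
    qed
  qed
qed (simp add: is_path_def)

text \<open>The convention \<open>f (Suc n) = m\<close> turns the final vertical stretch into an
  ordinary summand, so that all \<open>n + 1\<close> height differences are treated alike.\<close>

lemma fpio_passage_ge:
  assumes "is_path p (0, 0) (int n, m)" "semi_directed p"
  defines "f \<equiv> fpio p n m"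
  shows "f 0 = 0" and "f (Suc n) = m"
    and "(\<Sum>k<n. \<omega> (int k, f (Suc k))) + (\<Sum>k\<le>n. real_of_int \<bar>f (Suc k) - f k\<bar>) \<le> passage \<omega> p"
proof -
  have f: "f k = first_height p k" if "k \<le> n" for k
    using that by (simp add: f_def fpio_def first_height_def)
  show fn: "f (Suc n) = m" by (simp add: f_def fpio_def)
  have *: "first_height p 0 = 0" "(\<Sum>k<n. \<omega> (int k, first_height p (Suc k)))
      + (\<Sum>k<n. real_of_int \<bar>first_height p (Suc k) - first_height p k\<bar>)
      + real_of_int \<bar>m - first_height p n\<bar> \<le> passage \<omega> p"
    using semi_directed_passage_ge[OF assms(1,2), of \<omega>] by auto
  show "f 0 = 0" using * f by simp
  have "{..n} = insert n {..<n}" by auto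
  then have "(\<Sum>k\<le>n. real_of_int \<bar>f (Suc k) - f k\<bar>)
     = real_of_int \<bar>f (Suc n) - f n\<bar> + (\<Sum>k<n. real_of_int \<bar>f (Suc k) - f k\<bar>)" by simp
  moreover have "(\<Sum>k<n. real_of_int \<bar>f (Suc k) - f k\<bar>)
     = (\<Sum>k<n. real_of_int \<bar>first_height p (Suc k) - first_height p k\<bar>)"
    "(\<Sum>k<n. \<omega> (int k, f (Suc k))) = (\<Sum>k<n. \<omega> (int k, first_height p (Suc k)))"
    using f by (auto intro!: sum.cong)
  ultimately show "(\<Sum>k<n. \<omega> (int k, f (Suc k))) + (\<Sum>k\<le>n. real_of_int \<bar>f (Suc k) - f k\<bar>) \<le> passage \<omega> p"
    using * fn f[of n] by simp
qed

section \<open>Tilting\<close>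

text \<open>An integer staircase of mean slope \<sigma>/q, started at 0 so that the origin stays
  fixed. For the phases \<open>s < q\<close> the places of the jumps partition the indices.\<close>

definition tilt :: "int \<Rightarrow> nat \<Rightarrow> nat \<Rightarrow> nat \<Rightarrow> int" where
  "tilt \<sigma> q s k = (\<Sum>i<k. if i mod q = s then \<sigma> else 0)"

text \<open>The offset \<open>q - 1 - s\<close> places the jumps: the quotient increases from
  \<open>k\<close> to \<open>k + 1\<close> exactly when \<open>k + q - s\<close> is a multiple of
  \<open>q\<close>, that is, when \<open>k\<close> leaves remainder \<open>s\<close>.\<close>

lemma tilt_eq:
  assumes "s < q"
  shows "tilt \<sigma> q s k = \<sigma> * int ((k + (q - 1 - s)) div q)"
proof (induction k)
  case 0
  then show ?case using assms by (simp add: tilt_def)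
next
  case (Suc k)
  have "Suc (k + (q - 1 - s)) mod q = 0 \<longleftrightarrow> k mod q = s"
  proof -
    have "Suc (k + (q - 1 - s)) = k + q - s" using assms by simp
    then have "Suc (k + (q - 1 - s)) mod q = 0 \<longleftrightarrow> (int k - int s) mod int q = 0"
      using assms by (simp add: of_nat_diff flip: of_nat_eq_0_iff[where 'a = int] add: zmod_int)
        (metis add_diff_eq add.commute diff_add_eq mod_add_self1)
    also have "\<dots> \<longleftrightarrow> int k mod int q = int s mod int q"
      by (simp add: mod_eq_dvd_iff dvd_eq_mod_eq_0)
    also have "\<dots> \<longleftrightarrow> k mod q = s" using assms by (metis mod_less of_nat_eq_iff zmod_int)
    finally show ?thesis .
  qed
  then have "Suc k + (q - 1 - s) = Suc (k + (q - 1 - s))"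
    "Suc (k + (q - 1 - s)) div q = (k + (q - 1 - s)) div q + (if k mod q = s then 1 else 0)"
    by (auto simp: div_Suc)
  moreover have "tilt \<sigma> q s (Suc k) = tilt \<sigma> q s k + (if k mod q = s then \<sigma> else 0)"
    by (simp add: tilt_def)
  ultimately show ?case using Suc by (simp only:) (simp add: algebra_simps)
qed

lemma tilt_approx:
  assumes "s < q"
  shows "\<bar>real_of_int (tilt \<sigma> q s (Suc n)) - real_of_int \<sigma> * real n / real q\<bar> \<le> \<bar>real_of_int \<sigma>\<bar>"
proof -
  define c where "c = (Suc n + (q - 1 - s)) div q"
  have "q * c \<le> Suc n + (q - 1 - s)" "Suc n + (q - 1 - s) < q * c + q"
    using assms dividend_less_times_div[of q "Suc n + (q - 1 - s)"]
    by (simp_all add: c_def del: add_Suc add_Suc_right)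
  then have "q * c \<le> n + q" "n < q * c + q" using assms by linarith+
  then have "real q * real c \<le> real n + real q" "real n \<le> real q * real c + real q"
    by (metis of_nat_add of_nat_le_iff of_nat_mult, metis less_imp_le of_nat_add of_nat_le_iff of_nat_mult)
  then have "\<bar>real c - real n / real q\<bar> \<le> 1" using assms by (auto simp: abs_le_iff field_simps)
  then have "\<bar>real_of_int \<sigma>\<bar> * \<bar>real c - real n / real q\<bar> \<le> \<bar>real_of_int \<sigma>\<bar>"
    by (simp add: mult_left_le)
  moreover have "real_of_int (tilt \<sigma> q s (Suc n)) - real_of_int \<sigma> * real n / real q
     = real_of_int \<sigma> * (real c - real n / real q)"
    using tilt_eq[OF assms, of \<sigma> "Suc n"] by (simp add: c_def algebra_simps)
  ultimately show ?thesis by (simp add: abs_mult)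
qed

text \<open>The successor in the tilt follows the profile convention: the edge from column
  \<open>k\<close> to \<open>k + 1\<close> is crossed at the height indexed by \<open>k + 1\<close>.
  Being a translation of each column, the tilt merely relabels the sites.\<close>

definition tilt_env :: "int \<Rightarrow> nat \<Rightarrow> nat \<Rightarrow> env \<Rightarrow> env" where
  "tilt_env \<sigma> q s \<omega> = (\<lambda>z. \<omega> (fst z, snd z - tilt \<sigma> q s (Suc (nat (fst z)))))"

text \<open>Shifting column \<open>k\<close> by the tilt moves the geodesic along with the environment and changes
  its vertical cost only at the jumps. Each column carries a jump for exactly one phase \<open>s\<close>.\<close>

lemma sum_V_tilt_le:
  assumes "is_path p (0, 0) (int n, m)" "semi_directed p" and nonneg: "\<forall>z. 0 \<le> \<omega> z" and "0 < q"
  defines "f \<equiv> fpio p n m"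
  shows "(\<Sum>s<q. V (tilt_env \<sigma> q s \<omega>) n (m + tilt \<sigma> q s (Suc n)))
    \<le> real q * passage \<omega> p
       + real_of_int (\<Sum>k\<le>n. \<bar>f (Suc k) - f k + \<sigma>\<bar> - \<bar>f (Suc k) - f k\<bar>)"
proof -
  note f = fpio_passage_ge[OF assms(1,2), folded f_def]
  define W where "W = (\<Sum>k<n. \<omega> (int k, f (Suc k)))"
  have V: "V (tilt_env \<sigma> q s \<omega>) n (m + tilt \<sigma> q s (Suc n))
     \<le> W + (\<Sum>k\<le>n. real_of_int \<bar>f (Suc k) - f k + (if k mod q = s then \<sigma> else 0)\<bar>)" for s
  proof -
    \<comment> \<open>The moved profile meets in the tilted environment the same horizontal weights
      as the original one, so only the vertical terms differ.\<close>
    let ?h = "\<lambda>k. f k + tilt \<sigma> q s k"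
    have "V (tilt_env \<sigma> q s \<omega>) n (?h (Suc n))
       \<le> (\<Sum>k<n. \<bar>tilt_env \<sigma> q s \<omega> (int k, ?h (Suc k))\<bar>) + (\<Sum>k\<le>n. real_of_int \<bar>?h (Suc k) - ?h k\<bar>)"
      by (rule V_le_cost) (simp add: f tilt_def)
    also have "(\<Sum>k<n. \<bar>tilt_env \<sigma> q s \<omega> (int k, ?h (Suc k))\<bar>) = W"
      unfolding W_def using nonneg by (intro sum.cong) (auto simp: tilt_env_def)
    also have "(\<Sum>k\<le>n. real_of_int \<bar>?h (Suc k) - ?h k\<bar>)
        = (\<Sum>k\<le>n. real_of_int \<bar>f (Suc k) - f k + (if k mod q = s then \<sigma> else 0)\<bar>)"
      by (intro sum.cong) (auto simp: tilt_def)
    finally show ?thesis by (simp add: f)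
  qed
  have "(\<Sum>s<q. V (tilt_env \<sigma> q s \<omega>) n (m + tilt \<sigma> q s (Suc n)))
     \<le> (\<Sum>s<q. W + (\<Sum>k\<le>n. real_of_int \<bar>f (Suc k) - f k + (if k mod q = s then \<sigma> else 0)\<bar>))"
    by (intro sum_mono V)
  also have "\<dots> = real q * W
     + (\<Sum>k\<le>n. \<Sum>s<q. real_of_int \<bar>f (Suc k) - f k + (if k mod q = s then \<sigma> else 0)\<bar>)"
    by (simp add: sum.distrib sum.swap[of _ "{..n}"])
  also have "(\<Sum>k\<le>n. \<Sum>s<q. real_of_int \<bar>f (Suc k) - f k + (if k mod q = s then \<sigma> else 0)\<bar>)
     = (\<Sum>k\<le>n. real q * real_of_int \<bar>f (Suc k) - f k\<bar>
          + real_of_int (\<bar>f (Suc k) - f k + \<sigma>\<bar> - \<bar>f (Suc k) - f k\<bar>))"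
  proof (intro sum.cong refl)
    fix k
    let ?d = "f (Suc k) - f k"
    have "(\<Sum>s<q. real_of_int \<bar>?d + (if k mod q = s then \<sigma> else 0)\<bar>)
       = (\<Sum>s<q. real_of_int \<bar>?d\<bar> + (if s = k mod q then real_of_int (\<bar>?d + \<sigma>\<bar> - \<bar>?d\<bar>) else 0))"
      by (intro sum.cong) auto
    also have "\<dots> = real q * real_of_int \<bar>?d\<bar> + real_of_int (\<bar>?d + \<sigma>\<bar> - \<bar>?d\<bar>)"
      using \<open>0 < q\<close> by (simp add: sum.distrib)
    finally show "(\<Sum>s<q. real_of_int \<bar>?d + (if k mod q = s then \<sigma> else 0)\<bar>)
        = real q * real_of_int \<bar>?d\<bar> + real_of_int (\<bar>?d + \<sigma>\<bar> - \<bar>?d\<bar>)" .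
  qed
  also have "\<dots> = real q * (\<Sum>k\<le>n. real_of_int \<bar>f (Suc k) - f k\<bar>)
      + real_of_int (\<Sum>k\<le>n. \<bar>f (Suc k) - f k + \<sigma>\<bar> - \<bar>f (Suc k) - f k\<bar>)"
    by (simp only: sum.distrib sum_distrib_left of_int_sum)
  also have "real q * W + (real q * (\<Sum>k\<le>n. real_of_int \<bar>f (Suc k) - f k\<bar>)
      + real_of_int (\<Sum>k\<le>n. \<bar>f (Suc k) - f k + \<sigma>\<bar> - \<bar>f (Suc k) - f k\<bar>))
     = real q * (W + (\<Sum>k\<le>n. real_of_int \<bar>f (Suc k) - f k\<bar>))
      + real_of_int (\<Sum>k\<le>n. \<bar>f (Suc k) - f k + \<sigma>\<bar> - \<bar>f (Suc k) - f k\<bar>)"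
    by (simp only: distrib_left add.assoc)
  also have "\<dots> \<le> real q * passage \<omega> p
      + real_of_int (\<Sum>k\<le>n. \<bar>f (Suc k) - f k + \<sigma>\<bar> - \<bar>f (Suc k) - f k\<bar>)"
    using f(3)[of \<omega>] unfolding W_def by (intro add_right_mono mult_left_mono) auto
  finally show ?thesis .
qed

text \<open>For an integer d, |d + 1| - |d| is 1 if d \<ge> 0 and -1 otherwise, while |d - 1| - |d|
  is 1 if d \<le> 0 and -1 otherwise. A flat step is charged 1 in either direction, which is why
  \<open>Rcount\<close> carries opposite signs in the two bounds.\<close>

lemma sum_tilt_counts:
  fixes p n m
  defines "f \<equiv> fpio p n m"
  shows "real_of_int (\<Sum>k\<le>n. \<bar>f (Suc k) - f k + 1\<bar> - \<bar>f (Suc k) - f k\<bar>)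
      = real (Ucount p n m) + real (Rcount p n m) - real (Dcount p n m)"
    and "real_of_int (\<Sum>k\<le>n. \<bar>f (Suc k) - f k + (-1)\<bar> - \<bar>f (Suc k) - f k\<bar>)
      = - (real (Ucount p n m) - real (Rcount p n m) - real (Dcount p n m))"
proof -
  have card: "real (card {k \<in> {0..n}. P k}) = (\<Sum>k\<le>n. if P k then 1 else 0)" for P
    by (simp add: atMost_atLeast0 flip: sum.inter_filter)
  show "real_of_int (\<Sum>k\<le>n. \<bar>f (Suc k) - f k + 1\<bar> - \<bar>f (Suc k) - f k\<bar>)
      = real (Ucount p n m) + real (Rcount p n m) - real (Dcount p n m)"
    unfolding Ucount_def Rcount_def Dcount_def card f_def[symmetric] of_int_sum
      sum.distrib[symmetric] sum_subtractf[symmetric] by (intro sum.cong) auto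
  show "real_of_int (\<Sum>k\<le>n. \<bar>f (Suc k) - f k + (-1)\<bar> - \<bar>f (Suc k) - f k\<bar>)
      = - (real (Ucount p n m) - real (Rcount p n m) - real (Dcount p n m))"
    unfolding Ucount_def Rcount_def Dcount_def card f_def[symmetric] of_int_sum
      sum.distrib[symmetric] sum_subtractf[symmetric] sum_negf[symmetric] by (intro sum.cong) auto
qed

section \<open>Subadditive sequences with independent increments\<close>

text \<open>The limit is the infimum of \<open>e n / n\<close>. Division with remainder by a
  near-optimal \<open>N\<close> gives the upper bound; \<open>B\<close> controls all remainders at
  once and disappears after division by \<open>n\<close>.\<close>

lemma fekete:
  fixes e :: "nat \<Rightarrow> real"
  assumes sub: "\<And>m n. e (m + n) \<le> e m + e n" and nonneg: "\<And>n. 0 \<le> e n"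
  shows "\<exists>c\<ge>0. (\<lambda>n. e n / real n) \<longlonglongrightarrow> c"
proof -
  define S where "S = (\<lambda>n. e n / real n) ` {0<..}"
  define c where "c = Inf S"
  have bdd: "bdd_below S" by (rule bdd_belowI[of _ 0]) (auto simp: S_def nonneg)
  have ne: "S \<noteq> {}" by (auto simp: S_def)
  have lower: "c \<le> e n / real n" if "n > 0" for n
    unfolding c_def using that by (intro cInf_lower bdd) (auto simp: S_def)
  have mult: "e (q * N + r) \<le> real q * e N + e r" for q N r
  proof (induction q)
    case (Suc q)
    have "e (Suc q * N + r) \<le> e N + e (q * N + r)" using sub[of N "q * N + r"] by (simp add: add.assoc)
    then show ?case using Suc by (simp add: algebra_simps)
  qed simp
  have "(\<lambda>n. e n / real n) \<longlonglongrightarrow> c"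
  proof (rule LIMSEQ_I)
    fix \<epsilon> :: real assume "\<epsilon> > 0"
    then obtain N where N: "N > 0" "e N / real N < c + \<epsilon> / 2"
      using cInf_lessD[OF ne, of "c + \<epsilon> / 2"] by (auto simp: c_def S_def)
    define B where "B = (\<Sum>r<N. e r)"
    have B: "e r \<le> B" if "r < N" for r
      unfolding B_def using that nonneg by (intro member_le_sum) auto
    obtain n0 :: nat where n0: "real n0 > 2 * B / \<epsilon>" using reals_Archimedean2 by blast
    have "\<bar>e n / real n - c\<bar> < \<epsilon>" if n: "n \<ge> Suc n0" for n
    proof -
      have "e n \<le> real (n div N) * e N + e (n mod N)" using mult[of "n div N" N "n mod N"] by simp
      also have "e (n mod N) \<le> B" using B N by simp
      also have "real (n div N) * e N \<le> real n / real N * e N"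
        using nonneg by (intro mult_right_mono) (auto simp: of_nat_div_le_of_nat)
      finally have "e n / real n \<le> (real n / real N * e N + B) / real n" by (simp add: divide_right_mono)
      also have "\<dots> = e N / real N + B / real n" using n by (simp add: field_simps)
      also have "B / real n < \<epsilon> / 2"
      proof -
        have "2 * B / \<epsilon> < real n" using n0 n by linarith
        then show ?thesis using \<open>\<epsilon> > 0\<close> n by (simp add: field_simps)
      qed
      finally show ?thesis using N lower[of n] n by linarith
    qed
    then show "\<exists>n0. \<forall>n\<ge>n0. norm (e n / real n - c) < \<epsilon>" by auto
  qed
  moreover have "c \<ge> 0" unfolding c_def using ne by (intro cInf_greatest) (auto simp: S_def nonneg)
  ultimately show ?thesis by blast
qed

section \<open>From dyadic subsequences to the whole sequence\<close>

lemma dyadic_block: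
  assumes "0 < K" "K \<le> (N::nat)"
  shows "\<exists>j n. K \<le> n \<and> n < 2 * K \<and> n * 2 ^ j \<le> N \<and> N < (n + 1) * 2 ^ j"
proof -
  let ?P = "\<lambda>j. N < K * 2 ^ Suc j"
  have "N < 2 ^ Suc N" using less_exp[of "Suc N"] by linarith
  also have "\<dots> \<le> K * 2 ^ Suc N" using assms by (simp del: power_Suc)
  finally have "N < K * 2 ^ Suc N" .
  then have ex: "\<exists>j. ?P j" by blast
  \<comment> \<open>The least such exponent puts \<open>N\<close> between \<open>K * 2 ^ j\<close>
    and \<open>2 * K * 2 ^ j\<close>, so the quotient by \<open>2 ^ j\<close> falls into a fixed
    finite window.\<close>
  define j where "j = (LEAST j. ?P j)"
  have up: "N < K * 2 ^ Suc j" unfolding j_def using ex by (rule LeastI_ex)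
  have lo: "K * 2 ^ j \<le> N"
  proof (cases j)
    case (Suc i)
    then have "\<not> ?P i" using not_less_Least[of i ?P] j_def by simp
    then show ?thesis using Suc by simp
  qed (use assms in simp)
  define n where "n = N div 2 ^ j"
  have "K \<le> n" unfolding n_def using lo by (simp add: less_eq_div_iff_mult_less_eq)
  moreover have "n < 2 * K" unfolding n_def using up by (simp add: div_less_iff_less_mult mult.commute mult.left_commute)
  moreover have "n * 2 ^ j \<le> N" "N < (n + 1) * 2 ^ j"
    unfolding n_def using dividend_less_div_times[of "2 ^ j" N] by auto
  ultimately show ?thesis by blast
qed

text \<open>Since the quotients stay in the finite window \<open>{K..2*K}\<close>, one threshold
  serves all subsequences involved. A block around \<open>N\<close> has length at most
  \<open>N / K\<close>, and almost monotonicity compares \<open>x N\<close> with the values at the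
  two ends, up to an error linear in the block length.\<close>

lemma dyadic_interpolation:
  fixes x :: "nat \<Rightarrow> real"
  assumes lim: "\<And>n. n > 0 \<Longrightarrow> (\<lambda>j. x (n * 2 ^ j) / real (n * 2 ^ j)) \<longlonglongrightarrow> c"
    and mono: "\<And>n k. x n \<le> x (n + k) + C * (real k + 1)" and "c \<ge> 0" "C \<ge> 0"
  shows "(\<lambda>n. x n / real n) \<longlonglongrightarrow> c"
proof (rule LIMSEQ_I)
  fix \<epsilon> :: real assume "\<epsilon> > 0"
  \<comment> \<open>Chosen so that the error (c + C) N / K caused by the block length stays below
    \<epsilon> N / 4; \<open>N1\<close> below does the same for the additive constant
    \<open>C\<close>.\<close>
  obtain K :: nat where "real K > (c + C) / (\<epsilon> / 4)" using reals_Archimedean2 by blast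
  moreover have "(c + C) / (\<epsilon> / 4) \<ge> 0" using assms(3,4) \<open>\<epsilon> > 0\<close> by simp
  ultimately have K: "K > 0" "real K > (c + C) / (\<epsilon> / 4)" by (auto intro: gr0I)
  then have K': "(c + C) / real K < \<epsilon> / 4" using \<open>\<epsilon> > 0\<close> by (simp add: field_simps)
  have "\<forall>\<^sub>F j in sequentially. \<forall>n\<in>{K..2*K}. \<bar>x (n * 2 ^ j) / real (n * 2 ^ j) - c\<bar> < \<epsilon> / 8"
  proof (intro eventually_ball_finite ballI)
    fix n assume "n \<in> {K..2*K}"
    then have "n > 0" using K by simp
    from lim[OF this] have "\<forall>\<^sub>F j in sequentially. dist (x (n * 2 ^ j) / real (n * 2 ^ j)) c < \<epsilon> / 8"
      using \<open>\<epsilon> > 0\<close> by (intro tendstoD) auto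
    then show "\<forall>\<^sub>F j in sequentially. \<bar>x (n * 2 ^ j) / real (n * 2 ^ j) - c\<bar> < \<epsilon> / 8"
      by (simp add: dist_real_def)
  qed simp
  then obtain j0 where "\<forall>j\<ge>j0. \<forall>n\<in>{K..2*K}. \<bar>x (n * 2 ^ j) / real (n * 2 ^ j) - c\<bar> < \<epsilon> / 8"
    unfolding eventually_sequentially by blast
  then have j0: "\<bar>x (n * 2 ^ j) / real (n * 2 ^ j) - c\<bar> < \<epsilon> / 8" if "j \<ge> j0" "K \<le> n" "n \<le> 2 * K" for j n
    using that by simp
  obtain N1 :: nat where N1: "real N1 > C / (\<epsilon> / 4)" using reals_Archimedean2 by blast
  have "\<bar>x N / real N - c\<bar> < \<epsilon>" if N: "N \<ge> max (Suc N1) (2 * K * 2 ^ j0)" for N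
  proof -
    have "K \<le> K * 2 ^ j0" by simp
    then have "K \<le> N" using N by linarith
    then obtain j n where jn: "K \<le> n" "n < 2 * K" "n * 2 ^ j \<le> N" "N < (n + 1) * 2 ^ j"
      using dyadic_block[OF K(1)] by blast
    have "j \<ge> j0"
    proof (rule ccontr)
      assume "\<not> j \<ge> j0"
      then have "(2::nat) ^ j \<le> 2 ^ j0" by simp
      then have "(n + 1) * 2 ^ j \<le> 2 * K * 2 ^ j0" using jn by (intro mult_le_mono) auto
      then show False using jn N by linarith
    qed
    define b where "b = (2::real) ^ j"
    have bpos: "b > 0" by (simp add: b_def)
    have nb: "real n * b \<le> real N" "real N \<le> (real n + 1) * b"
      using of_nat_mono[OF jn(3), where 'a = real] of_nat_mono[OF less_imp_le[OF jn(4)], where 'a = real]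
      by (simp_all add: b_def algebra_simps)
    have bK: "b \<le> real N / real K"
    proof -
      have "real K * b \<le> real n * b" using jn bpos by simp
      then show ?thesis using nb K by (simp add: field_simps)
    qed
    have Npos: "real N > 0" using N by simp
    have approx: "\<bar>x (i * 2 ^ j) - c * (real i * b)\<bar> \<le> \<epsilon> / 8 * (real i * b)" if "K \<le> i" "i \<le> 2 * K" for i
    proof -
      have pos: "real i * b > 0" using that K bpos by simp
      have "\<bar>x (i * 2 ^ j) / (real i * b) - c\<bar> \<le> \<epsilon> / 8"
        using j0[OF \<open>j \<ge> j0\<close> that] by (simp add: b_def)
      then have "\<bar>x (i * 2 ^ j) / (real i * b) - c\<bar> * (real i * b) \<le> \<epsilon> / 8 * (real i * b)"
        using pos by (intro mult_right_mono) auto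
      moreover have "\<bar>x (i * 2 ^ j) / (real i * b) - c\<bar> * (real i * b)
         = \<bar>(x (i * 2 ^ j) / (real i * b) - c) * (real i * b)\<bar>"
        using pos bpos by (simp add: abs_mult)
      moreover have "(x (i * 2 ^ j) / (real i * b) - c) * (real i * b) = x (i * 2 ^ j) - c * (real i * b)"
        using pos K that bpos by (simp add: left_diff_distrib)
      ultimately show ?thesis by simp
    qed
    have b2: "real (2 ^ j) = b" by (simp add: b_def)
    have up: "x N \<le> x ((n + 1) * 2 ^ j) + C * (b + 1)"
    proof -
      obtain k where k: "(n + 1) * 2 ^ j = N + k" using jn(4) less_imp_add_positive by metis
      then have "k \<le> 2 ^ j" using jn(3) by simp
      then have "real k \<le> b" using b2 of_nat_le_iff by metis
      then show ?thesis using mono[of N k] k \<open>C \<ge> 0\<close> by (smt (verit) mult_left_mono)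
    qed
    have lo: "x (n * 2 ^ j) \<le> x N + C * (b + 1)"
    proof -
      obtain k where k: "N = n * 2 ^ j + k" using jn(3) le_iff_add by blast
      then have "k \<le> 2 ^ j" using jn(4) by simp
      then have "real k \<le> b" using b2 of_nat_le_iff by metis
      then show ?thesis using mono[of "n * 2 ^ j" k] k \<open>C \<ge> 0\<close> by (smt (verit) mult_left_mono)
    qed
    have n1: "(real n + 1) * b \<le> real N + b" "real N - b \<le> real n * b"
      using nb by (simp_all add: algebra_simps)
    have "1 \<le> real K" using K by simp
    from mult_left_mono[OF this, of "real N"] have "real N / real K \<le> real N"
      using K by (simp add: pos_divide_le_eq)
    then have bN: "b \<le> real N" using bK by linarith
    define u where "u = real N / real K"
    have cb: "c * b \<le> c * u" "C * b \<le> C * u"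
      using bK[folded u_def] assms(3,4) by (intro mult_left_mono; simp)+
    have "x N \<le> c * ((real n + 1) * b) + \<epsilon> / 8 * ((real n + 1) * b) + C * (b + 1)"
    proof -
      have "\<bar>x ((n + 1) * 2 ^ j) - c * (real (n + 1) * b)\<bar> \<le> \<epsilon> / 8 * (real (n + 1) * b)"
        by (rule approx) (use jn in auto)
      moreover have "real (n + 1) = real n + 1" by simp
      ultimately show ?thesis using up abs_le_D1 by (smt (verit))
    qed
    also have "\<dots> \<le> c * (real N + b) + \<epsilon> / 8 * (2 * real N) + C * (b + 1)"
      using n1 bN \<open>c \<ge> 0\<close> \<open>C \<ge> 0\<close> \<open>\<epsilon> > 0\<close> by (intro add_mono mult_left_mono) auto
    also have "\<dots> \<le> c * real N + (c + C) * u + \<epsilon> / 4 * real N + C"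
      using cb by (simp add: algebra_simps)
    finally have U: "x N \<le> c * real N + (c + C) * u + \<epsilon> / 4 * real N + C" .
    have cN: "c * (real N - b) \<le> c * (real n * b)" using n1 \<open>c \<ge> 0\<close> by (intro mult_left_mono) auto
    have eN: "\<epsilon> / 8 * (real n * b) \<le> \<epsilon> / 4 * real N"
      using nb Npos bpos \<open>\<epsilon> > 0\<close> by (intro mult_mono) auto
    have L: "x N \<ge> c * real N - (c + C) * u - \<epsilon> / 4 * real N - C"
    proof -
      have "\<bar>x (n * 2 ^ j) - c * (real n * b)\<bar> \<le> \<epsilon> / 8 * (real n * b)"
        by (rule approx) (use jn in auto)
      then have "c * (real n * b) - \<epsilon> / 8 * (real n * b) \<le> x N + C * (b + 1)" using lo by linarith
      then show ?thesis
        using cb cN eN unfolding distrib_left distrib_right right_diff_distrib by linarith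
    qed
    have 1: "(c + C) * u < \<epsilon> / 4 * real N"
      using mult_strict_right_mono[OF K' Npos] by (simp add: u_def)
    have "C / (\<epsilon> / 4) < real N" using N1 N by linarith
    then have 2: "C < \<epsilon> / 4 * real N" using \<open>\<epsilon> > 0\<close> by (simp add: field_simps)
    \<comment> \<open>Three errors remain, each at most \<epsilon> N / 4.\<close>
    have "\<bar>x N - c * real N\<bar> < \<epsilon> * real N"
      using U L 1 2 by (simp add: abs_less_iff)
    moreover have "x N / real N - c = (x N - c * real N) / real N" using Npos by (simp add: field_simps)
    ultimately show ?thesis using Npos by (simp add: abs_divide pos_divide_less_eq)
  qed
  then show "\<exists>n0. \<forall>n\<ge>n0. norm (x n / real n - c) < \<epsilon>"
    unfolding real_norm_def by blast
qed

text \<open>By monotone convergence the series of squares has finite mean, so it is finite almost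
  surely and its terms tend to 0.\<close>

lemma (in prob_space) AE_tendsto_0_of_summable_second_moment:
  fixes Y :: "nat \<Rightarrow> 'a \<Rightarrow> real"
  assumes [measurable]: "\<And>j. Y j \<in> borel_measurable M"
    and int: "\<And>j. integrable M (\<lambda>x. (Y j x)\<^sup>2)" and sum: "summable (\<lambda>j. expectation (\<lambda>x. (Y j x)\<^sup>2))"
  shows "AE x in M. (\<lambda>j. Y j x) \<longlonglongrightarrow> 0"
proof -
  have "(\<integral>\<^sup>+x. (\<Sum>j. ennreal ((Y j x)\<^sup>2)) \<partial>M) = (\<Sum>j. \<integral>\<^sup>+x. ennreal ((Y j x)\<^sup>2) \<partial>M)"
    by (rule nn_integral_suminf) simp
  also have "\<dots> = (\<Sum>j. ennreal (expectation (\<lambda>x. (Y j x)\<^sup>2)))"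
    by (simp add: nn_integral_eq_integral[OF int])
  also have "\<dots> = ennreal (\<Sum>j. expectation (\<lambda>x. (Y j x)\<^sup>2))"
    by (rule suminf_ennreal2) (auto intro: sum)
  finally have "(\<integral>\<^sup>+x. (\<Sum>j. ennreal ((Y j x)\<^sup>2)) \<partial>M) \<noteq> \<infinity>" by simp
  then have "AE x in M. (\<Sum>j. ennreal ((Y j x)\<^sup>2)) \<noteq> \<infinity>"
    by (intro nn_integral_PInf_AE) measurable
  then show ?thesis
  proof eventually_elim
    case (elim x)
    then have "summable (\<lambda>j. (Y j x)\<^sup>2)" by (intro summable_suminf_not_top) auto
    then have "(\<lambda>j. (Y j x)\<^sup>2) \<longlonglongrightarrow> 0" by (rule summable_LIMSEQ_zero)
    then have "(\<lambda>j. sqrt ((Y j x)\<^sup>2)) \<longlonglongrightarrow> sqrt 0" by (intro tendsto_real_sqrt)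
    then show ?case by (simp add: tendsto_rabs_zero_iff)
  qed
qed

text \<open>Hammersley's trick: dividing the second moment bound by \<open>(2n)\<^sup>2\<close> makes the variances of
  \<open>X\<^sub>N / N\<close> along \<open>N = n 2\<^sup>j\<close> telescope against the squared means, so they are summable.\<close>

lemma (in prob_space) subadditive_limit:
  fixes X :: "nat \<Rightarrow> 'a \<Rightarrow> real"
  assumes meas [measurable]: "\<And>n. X n \<in> borel_measurable M" and nonneg: "\<And>n x. 0 \<le> X n x"
    and sq: "\<And>n. integrable M (\<lambda>x. (X n x)\<^sup>2)"
    and sub: "\<And>m n. expectation (X (m + n)) \<le> expectation (X m) + expectation (X n)"
    and sub2: "\<And>n. expectation (\<lambda>x. (X (n + n) x)\<^sup>2)
       \<le> 2 * expectation (\<lambda>x. (X n x)\<^sup>2) + 2 * (expectation (X n))\<^sup>2"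
    and mono: "\<And>n k x. X n x \<le> X (n + k) x + C * (real k + 1)" and "C \<ge> 0"
  shows "\<exists>c. (\<lambda>n. expectation (X n) / real n) \<longlonglongrightarrow> c \<and> (AE x in M. (\<lambda>n. X n x / real n) \<longlonglongrightarrow> c)"
proof -
  have int: "integrable M (X n)" for n
    using square_integrable_imp_integrable[OF meas sq] .
  obtain c where c: "c \<ge> 0" "(\<lambda>n. expectation (X n) / real n) \<longlonglongrightarrow> c"
    using fekete[of "\<lambda>n. expectation (X n)"] sub nonneg by (auto intro!: integral_nonneg_AE)
  have dyadic: "AE x in M. (\<lambda>j. X (n * 2 ^ j) x / real (n * 2 ^ j)) \<longlonglongrightarrow> c" if "n > 0" for n
  proof -
    define N where "N j = n * 2 ^ j" for j :: nat
    have N0: "real (N j) > 0" and N2: "N (Suc j) = N j + N j" for j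
      using that by (auto simp: N_def)
    define \<mu> where "\<mu> j = expectation (X (N j)) / real (N j)" for j
    define Y where "Y j x = X (N j) x / real (N j) - \<mu> j" for j x
    have [measurable]: "Y j \<in> borel_measurable M" for j unfolding Y_def by measurable
    have Ysq: "(\<lambda>x. (Y j x)\<^sup>2) = (\<lambda>x. (X (N j) x)\<^sup>2 / (real (N j))\<^sup>2 - 2 * \<mu> j / real (N j) * X (N j) x + (\<mu> j)\<^sup>2)" for j
      by (auto simp: Y_def power2_diff power_divide algebra_simps)
    have Yint: "integrable M (\<lambda>x. (Y j x)\<^sup>2)" for j
      unfolding Ysq using sq int by (intro Bochner_Integration.integrable_add Bochner_Integration.integrable_diff) auto
    define W where "W j = expectation (\<lambda>x. (Y j x)\<^sup>2)" for j
    have W: "W j = expectation (\<lambda>x. (X (N j) x)\<^sup>2) / (real (N j))\<^sup>2 - (\<mu> j)\<^sup>2" for j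
    proof -
      have "W j = expectation (\<lambda>x. (X (N j) x)\<^sup>2) / (real (N j))\<^sup>2
          - 2 * \<mu> j / real (N j) * expectation (X (N j)) + (\<mu> j)\<^sup>2"
        unfolding W_def Ysq using sq int by (simp add: prob_space)
      also have "2 * \<mu> j / real (N j) * expectation (X (N j)) = 2 * (\<mu> j)\<^sup>2"
        using N0[of j] by (simp add: \<mu>_def power2_eq_square)
      finally show ?thesis by simp
    qed
    have W0: "0 \<le> W j" for j unfolding W_def by simp
    have step: "W (Suc j) \<le> W j / 2 + ((\<mu> j)\<^sup>2 - (\<mu> (Suc j))\<^sup>2)" for j
    proof -
      have "expectation (\<lambda>x. (X (N (Suc j)) x)\<^sup>2) / (real (N (Suc j)))\<^sup>2
         \<le> (2 * expectation (\<lambda>x. (X (N j) x)\<^sup>2) + 2 * (expectation (X (N j)))\<^sup>2) / (real (N (Suc j)))\<^sup>2"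
        unfolding N2 using sub2[of "N j"] by (intro divide_right_mono) auto
      also have "\<dots> = (expectation (\<lambda>x. (X (N j) x)\<^sup>2) / (real (N j))\<^sup>2 + (\<mu> j)\<^sup>2) / 2"
        using N0[of j] unfolding N2 \<mu>_def by (simp add: field_simps power2_eq_square)
      finally show ?thesis using W[of j] W[of "Suc j"] by (simp add: field_simps)
    qed
    have partial: "(\<Sum>j<J. W (Suc j)) \<le> (\<Sum>j<J. W j) / 2 + (\<mu> 0)\<^sup>2 - (\<mu> J)\<^sup>2" for J
    proof (induction J)
      case (Suc J)
      then show ?case using step[of J] by (simp add: field_simps)
    qed simp
    \<comment> \<open>The shifted sum is at most half the sum itself plus a constant, so the sum can
      be absorbed into the left side.\<close>
    have "(\<Sum>j<J. W j) \<le> 2 * (W 0 + (\<mu> 0)\<^sup>2)" for J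
    proof -
      have "(\<Sum>j<J. W j) \<le> (\<Sum>j<Suc J. W j)" using W0 by simp
      also have "\<dots> = W 0 + (\<Sum>j<J. W (Suc j))" by (rule sum.lessThan_Suc_shift)
      also have "\<dots> \<le> W 0 + ((\<Sum>j<J. W j) / 2 + (\<mu> 0)\<^sup>2)" using partial[of J] by (smt (verit) zero_le_power2)
      finally show ?thesis by simp
    qed
    then have "summable W" using W0 by (intro bounded_imp_summable[where B = "2 * (W 0 + (\<mu> 0)\<^sup>2)"])
        (simp_all only: lessThan_Suc_atMost[symmetric])
    then have "AE x in M. (\<lambda>j. Y j x) \<longlonglongrightarrow> 0"
      unfolding W_def by (intro AE_tendsto_0_of_summable_second_moment Yint) auto
    moreover have "\<mu> \<longlonglongrightarrow> c"
    proof -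
      have "strict_mono N" unfolding strict_mono_Suc_iff using N2 N0 by simp
      from LIMSEQ_subseq_LIMSEQ[OF c(2) this] show ?thesis by (simp add: \<mu>_def[abs_def] o_def)
    qed
    then have "(\<lambda>j. Y j x) \<longlonglongrightarrow> 0 \<Longrightarrow> (\<lambda>j. X (N j) x / real (N j)) \<longlonglongrightarrow> c" for x
      using tendsto_add[of "\<lambda>j. Y j x" 0 sequentially \<mu> c] by (simp add: Y_def)
    ultimately show ?thesis unfolding N_def by (auto elim: eventually_mono)
  qed
  have "AE x in M. \<forall>n. n > 0 \<longrightarrow> (\<lambda>j. X (n * 2 ^ j) x / real (n * 2 ^ j)) \<longlonglongrightarrow> c"
    unfolding AE_all_countable using dyadic by auto
  then have "AE x in M. (\<lambda>n. X n x / real n) \<longlonglongrightarrow> c"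
  proof eventually_elim
    case (elim x)
    show ?case
      by (rule dyadic_interpolation[where C = C]) (use elim mono c(1) \<open>C \<ge> 0\<close> in auto)
  qed
  with c show ?thesis by blast
qed

section \<open>The random environment\<close>

text \<open>Writing \<open>r = t ^ 3\<close>, two factors \<open>t ^ j\<close> tame the square,
  since \<open>j * t ^ j\<close> is bounded, and the third leaves a geometric series.\<close>

lemma summable_quadratic_geometric:
  fixes r M :: real
  assumes "0 \<le> r" "r < 1"
  shows "summable (\<lambda>j. (2 * real j + M)\<^sup>2 * r ^ j)"
proof -
  define t where "t = root 3 r"
  have t: "0 \<le> t" "t < 1" "t ^ 3 = r"
    using assms by (auto simp: t_def real_root_pow_pos2)
  have "(\<lambda>j. 2 * (real j * t ^ j) + M * t ^ j) \<longlonglongrightarrow> 2 * 0 + M * 0"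
    using t by (intro tendsto_intros powser_times_n_limit_0 LIMSEQ_power_zero) auto
  then have "Bseq (\<lambda>j. 2 * (real j * t ^ j) + M * t ^ j)" by (intro convergent_imp_Bseq convergentI)
  then obtain B where B: "\<And>j. \<bar>2 * (real j * t ^ j) + M * t ^ j\<bar> \<le> B"
    by (auto simp: Bseq_def)
  show ?thesis
  proof (rule summable_comparison_test[of _ "\<lambda>j. B\<^sup>2 * t ^ j"])
    have "(2 * real j + M)\<^sup>2 * r ^ j \<le> B\<^sup>2 * t ^ j" for j
    proof -
      have "(2 * real j + M)\<^sup>2 * r ^ j = (2 * (real j * t ^ j) + M * t ^ j)\<^sup>2 * t ^ j"
        using t(3)[symmetric] by (simp add: power_mult[symmetric] power2_eq_square power3_eq_cube algebra_simps)
      also have "\<dots> \<le> B\<^sup>2 * t ^ j"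
        using B[of j] t by (intro mult_right_mono) (auto simp: abs_le_square_iff[symmetric])
      finally show ?thesis .
    qed
    then show "\<exists>N. \<forall>j\<ge>N. norm ((2 * real j + M)\<^sup>2 * r ^ j) \<le> B\<^sup>2 * t ^ j"
      using assms by auto
    show "summable (\<lambda>j. B\<^sup>2 * t ^ j)" using t by (intro summable_mult summable_geometric) auto
  qed
qed

locale weight_law =
  fixes G :: "real measure"
  assumes prob_G: "prob_space G" and sets_G: "sets G = sets borel" and nonneg_G: "measure G {0..} = 1"
begin

abbreviation "E \<equiv> env_measure G"

sublocale G: prob_space G by (rule prob_G)

sublocale P: product_prob_space "\<lambda>_::point. G" UNIV by unfold_locales

sublocale prob_space E
  unfolding env_measure_def by (rule P.prob_space_axioms)

lemma space_G [simp]: "space G = UNIV"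
  using sets_eq_imp_space_eq[OF sets_G] by simp

lemma space_E [simp]: "space E = UNIV"
  by (simp add: env_measure_def space_PiM)

lemma prob_UNIV [simp]: "prob UNIV = 1"
  using prob_space by simp

lemma component_measurable_G: "(\<lambda>\<omega>. \<omega> z) \<in> measurable E G"
  unfolding env_measure_def by (rule measurable_component_singleton) simp

lemma component_measurable [measurable]: "(\<lambda>\<omega>. \<omega> z) \<in> borel_measurable E"
  using component_measurable_G measurable_cong_sets[OF refl sets_G] by blast

lemma V_borel_measurable [measurable]: "(\<lambda>\<omega>. V \<omega> n m) \<in> borel_measurable E"
  by (rule V_measurable) measurable

lemma AE_nonneg: "AE \<omega> in E. \<forall>z. 0 \<le> \<omega> z"
proof -
  have "AE x in G. x \<in> {0..}"
    using nonneg_G sets_G by (intro G.AE_prob_1) auto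
  then have "AE x in G. 0 \<le> x" by simp
  then show ?thesis unfolding AE_all_countable env_measure_def
    by (intro allI AE_PiM_component[where P = "\<lambda>x. 0 \<le> x"]) (auto simp: prob_G)
qed

section \<open>Relabelling invariance and independence\<close>

lemma reindex_measurable: "(\<lambda>\<omega> z. \<omega> (\<phi> z)) \<in> measurable E E"
  unfolding env_measure_def
  by (rule measurable_PiM_single') (auto simp: space_PiM intro!: measurable_component_singleton)

text \<open>Reading independent, identically distributed weights at distinct sites gives the same
  law again. Translations, the reflection of heights and the tilt are all instances.\<close>

lemma distr_reindex: "inj \<phi> \<Longrightarrow> distr E E (\<lambda>\<omega> z. \<omega> (\<phi> z)) = E"
  using distr_PiM_reindex[of UNIV "\<lambda>_. G" \<phi> UNIV] by (simp add: env_measure_def prob_G restrict_UNIV)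

lemma AE_reindex:
  assumes "inj \<phi>" "AE \<omega> in E. Q \<omega>"
  shows "AE \<omega> in E. Q (\<lambda>z. \<omega> (\<phi> z))"
proof -
  have "AE \<omega> in distr E E (\<lambda>\<omega> z. \<omega> (\<phi> z)). Q \<omega>" using assms by (simp only: distr_reindex)
  then show ?thesis by (rule AE_distrD[OF reindex_measurable])
qed

lemma integral_reindex:
  fixes f :: "env \<Rightarrow> real"
  assumes "inj \<phi>" "f \<in> borel_measurable E"
  shows "expectation (\<lambda>\<omega>. f (\<lambda>z. \<omega> (\<phi> z))) = expectation f"
  using integral_distr[OF reindex_measurable[of \<phi>] assms(2)] distr_reindex[OF assms(1)] by simp

lemma integrable_reindex:
  fixes f :: "env \<Rightarrow> real"
  assumes "inj \<phi>" "integrable E f"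
  shows "integrable E (\<lambda>\<omega>. f (\<lambda>z. \<omega> (\<phi> z)))"
  by (rule integrable_distr[OF reindex_measurable[of \<phi>]]) (use assms in \<open>simp add: distr_reindex\<close>)

lemma indep_components: "indep_vars (\<lambda>_. G) (\<lambda>z \<omega>. \<omega> z) UNIV"
proof (subst indep_vars_iff_distr_eq_PiM)
  have "distr E G (\<lambda>\<omega>. \<omega> z) = G" for z
    unfolding env_measure_def by (rule distr_PiM_component) (auto simp: prob_G)
  moreover have "distr E (PiM UNIV (\<lambda>_. G)) (\<lambda>\<omega>. \<omega>) = PiM UNIV (\<lambda>_. G)"
    unfolding env_measure_def by (rule distr_id)
  ultimately show "distr E (PiM UNIV (\<lambda>_. G)) (\<lambda>\<omega>. \<lambda>z\<in>UNIV. \<omega> z) = (\<Pi>\<^sub>M z\<in>UNIV. distr E G (\<lambda>\<omega>. \<omega> z))"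
    by (simp add: restrict_UNIV)
qed (auto simp: component_measurable_G)

abbreviation shift :: "nat \<Rightarrow> int \<Rightarrow> env \<Rightarrow> env" where
  "shift n m \<omega> \<equiv> (\<lambda>z. \<omega> (fst z + int n, snd z + m))"

lemma inj_shift: "inj (\<lambda>z::point. (fst z + int n, snd z + m))"
  by (auto simp: inj_def prod_eq_iff)

text \<open>The first variable reads only columns before \<open>n\<close>, the second only columns
  from \<open>n\<close> on. By \<open>V_cong\<close> and \<open>V_measurable\<close> both factor
  through restrictions to these disjoint sets of sites.\<close>

lemma indep_V_shift: "indep_var borel (\<lambda>\<omega>. V \<omega> n a) borel (\<lambda>\<omega>. V (shift n b \<omega>) k c)"
proof -
  define A B :: "point set" where "A = {z. fst z < int n}" and "B = {z. int n \<le> fst z}"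
  have ind: "indep_var (PiM A (\<lambda>_. G)) (\<lambda>\<omega>. restrict (\<lambda>z. \<omega> z) A) (PiM B (\<lambda>_. G)) (\<lambda>\<omega>. restrict (\<lambda>z. \<omega> z) B)"
    by (rule indep_var_restrict[OF indep_components]) (auto simp: A_def B_def)
  have comp: "(\<lambda>\<omega>. \<omega> z) \<in> borel_measurable (PiM I (\<lambda>_. G))" if "z \<in> I" for z :: point and I
    using measurable_component_singleton[OF that, of "\<lambda>_. G"] measurable_cong_sets[OF refl sets_G] by blast
  have "indep_var borel ((\<lambda>\<omega>. V \<omega> n a) \<circ> (\<lambda>\<omega>. restrict (\<lambda>z. \<omega> z) A))
     borel ((\<lambda>\<omega>. V (shift n b \<omega>) k c) \<circ> (\<lambda>\<omega>. restrict (\<lambda>z. \<omega> z) B))"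
    by (rule indep_var_compose[OF ind]) (auto intro!: V_measurable comp simp: A_def B_def)
  moreover have "(\<lambda>\<omega>. V \<omega> n a) \<circ> (\<lambda>\<omega>. restrict (\<lambda>z. \<omega> z) A) = (\<lambda>\<omega>. V \<omega> n a)"
    by (auto simp: o_def A_def intro!: ext V_cong)
  moreover have "(\<lambda>\<omega>. V (shift n b \<omega>) k c) \<circ> (\<lambda>\<omega>. restrict (\<lambda>z. \<omega> z) B) = (\<lambda>\<omega>. V (shift n b \<omega>) k c)"
    by (auto simp: o_def B_def intro!: ext V_cong)
  ultimately show ?thesis by simp
qed

text \<open>This holds even if \<open>G\<close> has infinite moments: the path can climb until it
  meets a weight at most \<open>M\<close>, cross there and return. After \<open>j\<close> failures
  this costs at most 2 j + M, and \<open>j\<close> successive failures have geometrically small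
  probability.\<close>

lemma V_1_square_integrable: "integrable E (\<lambda>\<omega>. (V \<omega> 1 0)\<^sup>2)"
proof -
  define A where "A M = {x::real. \<bar>x\<bar> \<le> real M}" for M :: nat
  have A_sets: "A M \<in> sets G" for M unfolding sets_G A_def by measurable
  have "(\<lambda>M. measure G (A M)) \<longlonglongrightarrow> measure G (\<Union>M. A M)"
    using A_sets by (intro G.finite_Lim_measure_incseq) (auto simp: incseq_def A_def)
  moreover have "(\<Union>M. A M) = space G" using real_arch_simple by (auto simp: A_def)
  ultimately have "(\<lambda>M. measure G (A M)) \<longlonglongrightarrow> 1" using G.prob_space by simp
  then have "\<forall>\<^sub>F M in sequentially. measure G (A M) > 0" by (rule order_tendstoD) simp
  \<comment> \<open>Besides positive mass within \<open>M\<close>, the bound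
    \<open>M \<ge> 1\<close> is kept so that all coefficients of the series below are at least
    1.\<close>
  then obtain M where M: "M \<ge> 1" "measure G (A M) > 0"
    unfolding eventually_sequentially by (metis max.cobounded1 max.cobounded2)
  define r where "r = measure G (- A M)"
  have "r = 1 - measure G (A M)" using G.prob_compl[OF A_sets[of M]] by (simp add: r_def Compl_eq_Diff_UNIV)
  then have r: "0 \<le> r" "r < 1" using M by (auto simp: r_def)
  have rA: "emeasure G (- A M) = ennreal r" by (simp add: r_def G.emeasure_eq_measure)
  \<comment> \<open>The event that the first \<open>j\<close> attempts, at heights 0 to j - 1, all
    fail.\<close>
  define B :: "nat \<Rightarrow> env set" where "B j = {\<omega>. \<forall>i\<in>(\<lambda>i. (0, int i)) ` {..<j}. \<omega> i \<in> - A M}" for j :: nat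
  have A_sets': "- A M \<in> sets G" using sets.compl_sets[OF A_sets[of M]] by (simp add: Compl_eq_Diff_UNIV)
  have B_em: "emeasure E (B j) = ennreal (r ^ j)" for j
  proof -
    have "emeasure E {x \<in> space E. \<forall>i\<in>(\<lambda>i. (0, int i)) ` {..<j}. x i \<in> - A M}
      = (\<Prod>i\<in>(\<lambda>i. (0::int, int i)) ` {..<j}. emeasure G (- A M))"
      unfolding env_measure_def
      by (rule P.emeasure_PiM_Collect) (use A_sets' in auto)
    also have "\<dots> = ennreal r ^ j"
      by (simp add: rA card_image inj_on_def)
    finally show ?thesis using r by (simp add: B_def ennreal_power)
  qed
  have B_sets [measurable]: "B j \<in> sets E" for j
  proof -
    have "B j = {\<omega>\<in>space E. \<forall>i<j. \<not> \<bar>\<omega> (0, int i)\<bar> \<le> real M}" by (auto simp: B_def A_def)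
    also have "\<dots> \<in> sets E" by measurable
    finally show ?thesis .
  qed
  have bound: "ennreal ((V \<omega> 1 0)\<^sup>2) \<le> (\<Sum>j. ennreal ((2 * real j + real M)\<^sup>2) * indicator (B j) \<omega>)" for \<omega>
  proof (cases "\<exists>j. \<bar>\<omega> (0, int j)\<bar> \<le> real M")
    case True
    define j where "j = (LEAST j. \<bar>\<omega> (0, int j)\<bar> \<le> real M)"
    have j: "\<bar>\<omega> (0, int j)\<bar> \<le> real M" unfolding j_def using True by (rule LeastI_ex)
    have "\<omega> \<in> B j" using not_less_Least[of _ "\<lambda>j. \<bar>\<omega> (0, int j)\<bar> \<le> real M"]
      by (auto simp: B_def A_def j_def)
    have "V \<omega> 1 0 \<le> 2 * real j + real M"
      using V_Suc_le[of \<omega> 0 0 "int j"] j by simp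
    then have "ennreal ((V \<omega> 1 0)\<^sup>2) \<le> ennreal ((2 * real j + real M)\<^sup>2)"
      by (intro ennreal_leI power_mono V_nonneg)
    also have "\<dots> = (\<Sum>i\<in>{j}. ennreal ((2 * real i + real M)\<^sup>2) * indicator (B i) \<omega>)"
      using \<open>\<omega> \<in> B j\<close> by simp
    also have "\<dots> \<le> (\<Sum>j. ennreal ((2 * real j + real M)\<^sup>2) * indicator (B j) \<omega>)"
      by (rule sum_le_suminf) auto
    finally show ?thesis .
  next
    case False
    \<comment> \<open>If every attempt fails, each term of the series is at least 1, so the series
      diverges and the bound is trivial.\<close>
    then have B: "\<omega> \<in> B j" for j by (auto simp: B_def A_def)
    obtain n :: nat where "(V \<omega> 1 0)\<^sup>2 \<le> real n" using real_arch_simple by blast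
    then have "ennreal ((V \<omega> 1 0)\<^sup>2) \<le> ennreal (real n)" by (rule ennreal_leI)
    also have "\<dots> = (\<Sum>i<n. 1)" by (simp add: ennreal_of_nat_eq_real_of_nat)
    also have "\<dots> \<le> (\<Sum>i<n. ennreal ((2 * real i + real M)\<^sup>2) * indicator (B i) \<omega>)"
    proof (rule sum_mono)
      fix i
      have "1 \<le> (2 * real i + real M)\<^sup>2" using M(1) by (intro one_le_power) simp
      then show "1 \<le> ennreal ((2 * real i + real M)\<^sup>2) * indicator (B i) \<omega>"
        using B by (simp add: ennreal_ge_1)
    qed
    also have "\<dots> \<le> (\<Sum>j. ennreal ((2 * real j + real M)\<^sup>2) * indicator (B j) \<omega>)"
      by (rule sum_le_suminf) auto
    finally show ?thesis .
  qed
  have "(\<integral>\<^sup>+\<omega>. ennreal ((V \<omega> 1 0)\<^sup>2) \<partial>E)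
     \<le> (\<integral>\<^sup>+\<omega>. (\<Sum>j. ennreal ((2 * real j + real M)\<^sup>2) * indicator (B j) \<omega>) \<partial>E)"
    by (intro nn_integral_mono bound)
  also have "\<dots> = (\<Sum>j. \<integral>\<^sup>+\<omega>. ennreal ((2 * real j + real M)\<^sup>2) * indicator (B j) \<omega> \<partial>E)"
    by (rule nn_integral_suminf) measurable
  also have "\<dots> = (\<Sum>j. ennreal ((2 * real j + real M)\<^sup>2 * r ^ j))"
    by (simp add: nn_integral_cmult_indicator B_em ennreal_mult'' r)
  also have "\<dots> = ennreal (\<Sum>j. (2 * real j + real M)\<^sup>2 * r ^ j)"
    using r by (intro suminf_ennreal2 summable_quadratic_geometric) auto
  also have "\<dots> < \<infinity>" by simp
  finally show ?thesis by (intro integrableI_nonneg) auto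
qed

section \<open>Moments of passage times and the law of large numbers\<close>

lemma square_integrable_add_bound:
  fixes f g h :: "env \<Rightarrow> real"
  assumes "integrable E (\<lambda>\<omega>. (f \<omega>)\<^sup>2)" "integrable E (\<lambda>\<omega>. (g \<omega>)\<^sup>2)" "h \<in> borel_measurable E"
    and "\<And>\<omega>. 0 \<le> h \<omega>" "\<And>\<omega>. h \<omega> \<le> f \<omega> + g \<omega>"
  shows "integrable E (\<lambda>\<omega>. (h \<omega>)\<^sup>2)"
proof (rule Bochner_Integration.integrable_bound[where f = "\<lambda>\<omega>. 2 * (f \<omega>)\<^sup>2 + 2 * (g \<omega>)\<^sup>2"])
  have "(h \<omega>)\<^sup>2 \<le> 2 * (f \<omega>)\<^sup>2 + 2 * (g \<omega>)\<^sup>2" for \<omega>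
  proof -
    have "(h \<omega>)\<^sup>2 \<le> (f \<omega> + g \<omega>)\<^sup>2" using assms(4,5) by (intro power_mono)
    also have "\<dots> \<le> 2 * (f \<omega>)\<^sup>2 + 2 * (g \<omega>)\<^sup>2"
      using sum_squares_bound[of "f \<omega>" "g \<omega>"] by (simp add: power2_sum)
    finally show ?thesis .
  qed
  then show "AE \<omega> in E. norm ((h \<omega>)\<^sup>2) \<le> norm (2 * (f \<omega>)\<^sup>2 + 2 * (g \<omega>)\<^sup>2)" by (auto intro: order_trans)
qed (use assms in auto)

lemma V_square_integrable: "integrable E (\<lambda>\<omega>. (V \<omega> n m)\<^sup>2)"
proof (induction n)
  case (Suc n)
  show ?case
  proof (rule square_integrable_add_bound[where f = "\<lambda>\<omega>. V \<omega> n m" and g = "\<lambda>\<omega>. V (shift n m \<omega>) 1 0"])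
    show "integrable E (\<lambda>\<omega>. (V (shift n m \<omega>) 1 0)\<^sup>2)"
      by (rule integrable_reindex[OF inj_shift V_1_square_integrable])
    show "V \<omega> (Suc n) m \<le> V \<omega> n m + V (shift n m \<omega>) 1 0" for \<omega>
      using V_subadditive[of \<omega> n 1 m 0] by simp
  qed (use Suc V_nonneg in auto)
qed simp

lemma V_integrable: "integrable E (\<lambda>\<omega>. V \<omega> n m)"
  by (rule square_integrable_imp_integrable) (auto intro: V_square_integrable)

lemma expectation_V_subadditive:
  "expectation (\<lambda>\<omega>. V \<omega> (n + k) (a + b)) \<le> expectation (\<lambda>\<omega>. V \<omega> n a) + expectation (\<lambda>\<omega>. V \<omega> k b)"
proof -
  have int: "integrable E (\<lambda>\<omega>. V (shift n a \<omega>) k b)"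
    by (rule integrable_reindex[OF inj_shift V_integrable])
  have "expectation (\<lambda>\<omega>. V \<omega> (n + k) (a + b)) \<le> expectation (\<lambda>\<omega>. V \<omega> n a + V (shift n a \<omega>) k b)"
    by (rule integral_mono) (auto intro!: V_integrable int V_subadditive)
  also have "\<dots> = expectation (\<lambda>\<omega>. V \<omega> n a) + expectation (\<lambda>\<omega>. V (shift n a \<omega>) k b)"
    by (rule Bochner_Integration.integral_add[OF V_integrable int])
  also have "expectation (\<lambda>\<omega>. V (shift n a \<omega>) k b) = expectation (\<lambda>\<omega>. V \<omega> k b)"
    by (rule integral_reindex[OF inj_shift]) simp
  finally show ?thesis .
qed

lemma expectation_V_lipschitz:
  "expectation (\<lambda>\<omega>. V \<omega> n a) \<le> expectation (\<lambda>\<omega>. V \<omega> n b) + real_of_int \<bar>a - b\<bar>"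
proof -
  have "expectation (\<lambda>\<omega>. V \<omega> n a) \<le> expectation (\<lambda>\<omega>. V \<omega> n b + real_of_int \<bar>a - b\<bar>)"
    by (rule integral_mono) (auto intro!: V_integrable V_lipschitz simp del: of_int_abs of_int_diff)
  also have "\<dots> = expectation (\<lambda>\<omega>. V \<omega> n b) + real_of_int \<bar>a - b\<bar>"
    by (simp add: V_integrable prob_space)
  finally show ?thesis .
qed

text \<open>The almost sure limit and the limit of the means coincide, so regularity of the limit
  can be read off expectations. Negative slopes are included, which the left derivative at 0
  requires.\<close>

lemma V_limit_exists:
  "\<exists>c. (\<lambda>n. expectation (\<lambda>\<omega>. V \<omega> n \<lceil>v * real n\<rceil>) / real n) \<longlonglongrightarrow> c
     \<and> (AE \<omega> in E. (\<lambda>n. V \<omega> n \<lceil>v * real n\<rceil> / real n) \<longlonglongrightarrow> c)"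
proof -
  define a where "a n = \<lceil>v * real n\<rceil>" for n
  \<comment> \<open>The added 1 absorbs the rounding, as \<open>a (m + n)\<close> and
    \<open>a m + a n\<close> differ by at most 1; it vanishes after division by
    \<open>n\<close>.\<close>
  define X where "X n \<omega> = V \<omega> n (a n) + 1" for n \<omega>
  have a_add: "\<bar>a (m + n) - (a m + a n)\<bar> \<le> 1" for m n
    unfolding a_def by (simp add: distrib_left abs_le_iff) linarith
  have X_sub: "X (m + n) \<omega> \<le> X m \<omega> + X n (shift m (a m) \<omega>)" for m n \<omega>
  proof -
    have "V \<omega> (m + n) (a (m + n)) \<le> V \<omega> (m + n) (a m + a n) + real_of_int \<bar>a (m + n) - (a m + a n)\<bar>"
      by (rule V_lipschitz)
    also have "real_of_int \<bar>a (m + n) - (a m + a n)\<bar> \<le> 1" using a_add[of m n] by linarith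
    finally show ?thesis using V_subadditive[of \<omega> m n "a m" "a n"] by (simp add: X_def)
  qed
  have X_meas [measurable]: "X n \<in> borel_measurable E" for n unfolding X_def by measurable
  have X_sq: "integrable E (\<lambda>\<omega>. (X n \<omega>)\<^sup>2)" for n
    unfolding X_def using V_square_integrable V_integrable
    by (simp add: power2_sum)
  have X_int: "integrable E (X n)" for n by (rule square_integrable_imp_integrable[OF X_meas X_sq])
  have sX_int: "integrable E (\<lambda>\<omega>. X n (shift m b \<omega>))" for m n b
    by (rule integrable_reindex[OF inj_shift X_int])
  have sX: "expectation (\<lambda>\<omega>. X n (shift m b \<omega>)) = expectation (X n)" for m n b
    by (rule integral_reindex[OF inj_shift]) simp
  have X0: "0 \<le> X n \<omega>" for n \<omega> using V_nonneg[of \<omega> n "a n"] by (simp add: X_def)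
  have "\<exists>c. (\<lambda>n. expectation (X n) / real n) \<longlonglongrightarrow> c \<and> (AE \<omega> in E. (\<lambda>n. X n \<omega> / real n) \<longlonglongrightarrow> c)"
  proof (rule subadditive_limit[where C = "\<bar>v\<bar> + 1"])
    fix m n
    have "expectation (X (m + n)) \<le> expectation (\<lambda>\<omega>. X m \<omega> + X n (shift m (a m) \<omega>))"
      by (rule integral_mono) (auto intro!: X_int sX_int X_sub)
    also have "\<dots> = expectation (X m) + expectation (X n)"
      using sX_int[of n m "a m"] by (simp add: X_int sX)
    finally show "expectation (X (m + n)) \<le> expectation (X m) + expectation (X n)" .
  next
    fix n
    \<comment> \<open>An independent copy of \<open>X n\<close>, so the mixed term of the squared
      sum has the squared mean of \<open>X n\<close> as its expectation.\<close>
    define Y where "Y \<omega> = X n (shift n (a n) \<omega>)" for \<omega>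
    have "indep_var borel ((\<lambda>x. x + 1) \<circ> (\<lambda>\<omega>. V \<omega> n (a n))) borel ((\<lambda>x. x + 1) \<circ> (\<lambda>\<omega>. V (shift n (a n) \<omega>) n (a n)))"
      by (rule indep_var_compose[OF indep_V_shift]) auto
    then have ind: "indep_var borel (X n) borel Y" by (simp add: o_def X_def[abs_def] Y_def[abs_def])
    have Y_int: "integrable E Y" "integrable E (\<lambda>\<omega>. (Y \<omega>)\<^sup>2)"
      unfolding Y_def by (rule sX_int, rule integrable_reindex[OF inj_shift X_sq])
    have eY: "expectation Y = expectation (X n)" "expectation (\<lambda>\<omega>. (Y \<omega>)\<^sup>2) = expectation (\<lambda>\<omega>. (X n \<omega>)\<^sup>2)"
      unfolding Y_def by (rule sX, rule integral_reindex[OF inj_shift]) simp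
    note XY = indep_var_integrable[OF ind X_int Y_int(1)] indep_var_lebesgue_integral[OF ind X_int Y_int(1)]
    have "expectation (\<lambda>\<omega>. (X (n + n) \<omega>)\<^sup>2) \<le> expectation (\<lambda>\<omega>. (X n \<omega>)\<^sup>2 + (Y \<omega>)\<^sup>2 + 2 * (X n \<omega> * Y \<omega>))"
    proof (rule integral_mono)
      show "(X (n + n) \<omega>)\<^sup>2 \<le> (X n \<omega>)\<^sup>2 + (Y \<omega>)\<^sup>2 + 2 * (X n \<omega> * Y \<omega>)" for \<omega>
        using power_mono[OF X_sub[of n n \<omega>] X0, of 2] by (simp add: Y_def power2_sum algebra_simps)
    qed (use X_sq Y_int XY in auto)
    also have "\<dots> = 2 * expectation (\<lambda>\<omega>. (X n \<omega>)\<^sup>2) + 2 * (expectation (X n))\<^sup>2"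
      using X_sq Y_int XY by (simp add: eY) (simp add: power2_eq_square)
    finally show "expectation (\<lambda>\<omega>. (X (n + n) \<omega>)\<^sup>2)
       \<le> 2 * expectation (\<lambda>\<omega>. (X n \<omega>)\<^sup>2) + 2 * (expectation (X n))\<^sup>2" .
  next
    fix n k \<omega>
    \<comment> \<open>Monotonicity in the number of columns is for a fixed height, whereas the
      target height moves by at most |v| k + 1; this explains the constant |v| + 1.\<close>
    have "\<bar>real_of_int (a (n + k) - a n)\<bar> \<le> \<bar>v * real k\<bar> + 1"
      unfolding a_def by (simp add: distrib_left) linarith
    also have "\<dots> \<le> (\<bar>v\<bar> + 1) * (real k + 1)" by (simp add: abs_mult algebra_simps)
    finally have "\<bar>real_of_int (a (n + k) - a n)\<bar> \<le> (\<bar>v\<bar> + 1) * (real k + 1)" .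
    moreover have "V \<omega> n (a n) \<le> V \<omega> (n + k) (a (n + k)) + \<bar>real_of_int (a (n + k) - a n)\<bar>"
      using V_lipschitz[of \<omega> n "a n" "a (n + k)"] V_mono[of n "n + k" \<omega> "a (n + k)"]
      by (simp add: abs_minus_commute)
    ultimately show "X n \<omega> \<le> X (n + k) \<omega> + (\<bar>v\<bar> + 1) * (real k + 1)" by (simp add: X_def)
  qed (use X_sq X0 in auto)
  then obtain c where c: "(\<lambda>n. expectation (X n) / real n) \<longlonglongrightarrow> c" "AE \<omega> in E. (\<lambda>n. X n \<omega> / real n) \<longlonglongrightarrow> c"
    by blast
  have "(\<lambda>n. expectation (X n) / real n - 1 / real n) \<longlonglongrightarrow> c - 0"
    by (intro tendsto_diff c(1) lim_1_over_n)
  moreover have "expectation (X n) / real n - 1 / real n = expectation (\<lambda>\<omega>. V \<omega> n (a n)) / real n" for n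
    by (simp add: X_def[abs_def] V_integrable prob_space add_divide_distrib)
  ultimately have "(\<lambda>n. expectation (\<lambda>\<omega>. V \<omega> n (a n)) / real n) \<longlonglongrightarrow> c" by simp
  moreover have "AE \<omega> in E. (\<lambda>n. V \<omega> n (a n) / real n) \<longlonglongrightarrow> c"
    using c(2)
  proof eventually_elim
    case (elim \<omega>)
    from tendsto_diff[OF elim lim_1_over_n] show ?case by (simp add: X_def add_divide_distrib)
  qed
  ultimately show ?thesis unfolding a_def by blast
qed

end

section \<open>The limit shape\<close>

lemma tendsto_perturb:
  fixes x y :: "nat \<Rightarrow> real"
  assumes "(\<lambda>n. x n / real n) \<longlonglongrightarrow> c" and "\<And>n. \<bar>y n - x n\<bar> \<le> K"
  shows "(\<lambda>n. y n / real n) \<longlonglongrightarrow> c"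
proof -
  have "(\<lambda>n. (y n - x n) / real n) \<longlonglongrightarrow> 0"
  proof (rule Lim_null_comparison)
    show "\<forall>\<^sub>F n in sequentially. norm ((y n - x n) / real n) \<le> K * (1 / real n)"
      using assms(2) by (auto intro!: always_eventually divide_right_mono)
    show "(\<lambda>n. K * (1 / real n)) \<longlonglongrightarrow> 0" using tendsto_mult[OF tendsto_const lim_1_over_n, of K] by simp
  qed
  from tendsto_add[OF assms(1) this] show ?thesis by (simp add: diff_divide_distrib)
qed

lemma tendsto_V_perturb:
  assumes "(\<lambda>n. V (\<omega> n) n (a n) / real n) \<longlonglongrightarrow> c" and "\<And>n. \<bar>real_of_int (a n) - real_of_int (b n)\<bar> \<le> K"
  shows "(\<lambda>n. V (\<omega> n) n (b n) / real n) \<longlonglongrightarrow> c"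
proof (rule tendsto_perturb[OF assms(1), of _ K])
  fix n
  show "\<bar>V (\<omega> n) n (b n) - V (\<omega> n) n (a n)\<bar> \<le> K"
    using V_lipschitz[of "\<omega> n" n "b n" "a n"] V_lipschitz[of "\<omega> n" n "a n" "b n"] assms(2)[of n]
    unfolding of_int_abs of_int_diff by linarith
qed

text \<open>\<open>dplus\<close> is built with \<open>Lim\<close>, which is informative only once a
  limit exists. Convexity makes the slopes monotone and the Lipschitz bound keeps them bounded
  below, so they converge.\<close>

lemma slope_tendsto_dplus:
  fixes f :: "real \<Rightarrow> real"
  assumes f: "convex_on UNIV f" and lip: "\<And>x y. \<bar>f x - f y\<bar> \<le> K * \<bar>x - y\<bar>"
  shows "((\<lambda>w. (f w - f v) / (w - v)) \<longlongrightarrow> dplus f v) (at_right v)"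
proof -
  have "((\<lambda>w. (f w - f v) / (w - v)) \<longlongrightarrow> Inf ((\<lambda>w. (f w - f v) / (w - v)) ` ({v<..} \<inter> UNIV)))
      (at v within ({v<..} \<inter> UNIV))"
  proof (rule Lim_right_bound[where K = "- K"])
    fix a b assume "v < a" "a \<le> b"
    then have "(f v - f a) / (v - a) \<le> (f v - f b) / (v - b)"
      using convex_on_slope_le(1)[OF f, of v b a] by (cases "a = b") auto
    then show "(f a - f v) / (a - v) \<le> (f b - f v) / (b - v)"
      by (metis minus_diff_eq minus_divide_divide)
  next
    fix a assume "v < a"
    then show "- K \<le> (f a - f v) / (a - v)"
      using lip[of a v] by (simp add: pos_le_divide_eq abs_le_iff)
  qed
  then have "\<exists>l. ((\<lambda>w. (f w - f v) / (w - v)) \<longlongrightarrow> l) (at_right v)" by auto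
  then show ?thesis unfolding dplus_def by (auto simp: tendsto_Lim)
qed

lemma slope_tendsto_dminus:
  fixes f :: "real \<Rightarrow> real"
  assumes f: "convex_on UNIV f" and lip: "\<And>x y. \<bar>f x - f y\<bar> \<le> K * \<bar>x - y\<bar>"
  shows "((\<lambda>w. (f v - f w) / (v - w)) \<longlongrightarrow> dminus f v) (at_left v)"
proof -
  have "((\<lambda>w. (f v - f w) / (v - w)) \<longlongrightarrow> Sup ((\<lambda>w. (f v - f w) / (v - w)) ` ({..<v} \<inter> UNIV)))
      (at v within ({..<v} \<inter> UNIV))"
  proof (rule Lim_left_bound[where K = K])
    fix a b assume "b < v" "a \<le> b"
    then have "(f a - f v) / (a - v) \<le> (f b - f v) / (b - v)"
      using convex_on_slope_le(2)[OF f, of a v b] by (cases "a = b") auto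
    then show "(f v - f a) / (v - a) \<le> (f v - f b) / (v - b)"
      by (metis minus_diff_eq minus_divide_divide)
  next
    fix a assume "a < v"
    then show "(f v - f a) / (v - a) \<le> K"
      using lip[of v a] by (simp add: pos_divide_le_eq abs_le_iff)
  qed
  then have "\<exists>l. ((\<lambda>w. (f v - f w) / (v - w)) \<longlongrightarrow> l) (at_left v)" by auto
  then show ?thesis unfolding dminus_def by (auto simp: tendsto_Lim)
qed

section \<open>Regularity of the limit and limits along tilts\<close>

context weight_law
begin

text \<open>Uniqueness for \<open>THE\<close>: under a probability measure, two almost sure limits
  hold simultaneously at some environment.\<close>

lemma Lambda0_eq:
  assumes "AE \<omega> in E. (\<lambda>n. V \<omega> n \<lceil>v * real n\<rceil> / real n) \<longlonglongrightarrow> c"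
  shows "Lambda0 G v = c"
  unfolding Lambda0_def
proof (rule the_equality)
  show T: "AE \<omega> in E. (\<lambda>n. T \<omega> (0, 0) (int n, \<lceil>v * real n\<rceil>) / real n) \<longlonglongrightarrow> c"
    using assms AE_nonneg by eventually_elim (simp add: T_eq_V)
  fix c' assume "AE \<omega> in E. (\<lambda>n. T \<omega> (0, 0) (int n, \<lceil>v * real n\<rceil>) / real n) \<longlonglongrightarrow> c'"
  with T have "AE \<omega> in E. c' = c" by eventually_elim (rule LIMSEQ_unique)
  then show "c' = c" by simp
qed

lemma Lambda_limit:
  shows expectation_tendsto_Lambda:
      "(\<lambda>n. expectation (\<lambda>\<omega>. V \<omega> n \<lceil>v * real n\<rceil>) / real n) \<longlonglongrightarrow> Lambda G v"
    and AE_tendsto_Lambda: "AE \<omega> in E. (\<lambda>n. V \<omega> n \<lceil>v * real n\<rceil> / real n) \<longlonglongrightarrow> Lambda G v"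
proof -
  obtain c where c: "(\<lambda>n. expectation (\<lambda>\<omega>. V \<omega> n \<lceil>v * real n\<rceil>) / real n) \<longlonglongrightarrow> c"
    "AE \<omega> in E. (\<lambda>n. V \<omega> n \<lceil>v * real n\<rceil> / real n) \<longlonglongrightarrow> c"
    using V_limit_exists by blast
  have "Lambda G v = c"
  proof (cases "v \<ge> 0")
    case True
    then show ?thesis using Lambda0_eq[OF c(2)] by (simp add: Lambda_def)
  next
    case False
    \<comment> \<open>For negative slopes \<open>Lambda\<close> uses |v|, and reflecting the heights
      preserves the law. Rounding before and after the change of sign differs by a bounded
      amount.\<close>
    have "inj (\<lambda>z::point. (fst z, - snd z))" by (auto simp: inj_def prod_eq_iff)
    from AE_reindex[OF this c(2)]
    have "AE \<omega> in E. (\<lambda>n. V \<omega> n (- \<lceil>v * real n\<rceil>) / real n) \<longlonglongrightarrow> c" by (simp add: V_reflect)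
    then have "AE \<omega> in E. (\<lambda>n. V \<omega> n \<lceil>- v * real n\<rceil> / real n) \<longlonglongrightarrow> c"
    proof eventually_elim
      case (elim \<omega>)
      have "\<bar>real_of_int (- \<lceil>v * real n\<rceil>) - real_of_int \<lceil>- v * real n\<rceil>\<bar> \<le> 2" for n
        by (simp add: abs_le_iff) linarith
      from tendsto_V_perturb[OF elim this] show ?case .
    qed
    from Lambda0_eq[OF this] show ?thesis using False by (simp add: Lambda_def)
  qed
  with c show "(\<lambda>n. expectation (\<lambda>\<omega>. V \<omega> n \<lceil>v * real n\<rceil>) / real n) \<longlonglongrightarrow> Lambda G v"
    "AE \<omega> in E. (\<lambda>n. V \<omega> n \<lceil>v * real n\<rceil> / real n) \<longlonglongrightarrow> Lambda G v" by auto
qed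

text \<open>A vertical detour costs 1 per unit, so mean passage times are Lipschitz in the height;
  rounding adds at most 1/n after scaling. The factor \<open>1 *\<close> fits the hypothesis of the
  slope lemmas.\<close>

lemma Lambda_lipschitz: "\<bar>Lambda G x - Lambda G y\<bar> \<le> 1 * \<bar>x - y\<bar>"
proof -
  have *: "Lambda G x \<le> Lambda G y + \<bar>x - y\<bar>" for x y
  proof (rule LIMSEQ_le[OF expectation_tendsto_Lambda])
    show "(\<lambda>n. expectation (\<lambda>\<omega>. V \<omega> n \<lceil>y * real n\<rceil>) / real n + \<bar>x - y\<bar> + 1 / real n) \<longlonglongrightarrow> Lambda G y + \<bar>x - y\<bar>"
      using tendsto_add[OF tendsto_add[OF expectation_tendsto_Lambda tendsto_const] lim_1_over_n] by simp
    have "expectation (\<lambda>\<omega>. V \<omega> n \<lceil>x * real n\<rceil>) / real n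
        \<le> expectation (\<lambda>\<omega>. V \<omega> n \<lceil>y * real n\<rceil>) / real n + \<bar>x - y\<bar> + 1 / real n" if "n \<ge> 1" for n
    proof -
      have "\<bar>x * real n - y * real n\<bar> = \<bar>x - y\<bar> * real n"
        by (simp add: abs_mult flip: left_diff_distrib)
      then have "real_of_int \<bar>\<lceil>x * real n\<rceil> - \<lceil>y * real n\<rceil>\<bar> \<le> \<bar>x - y\<bar> * real n + 1" by linarith
      then have "expectation (\<lambda>\<omega>. V \<omega> n \<lceil>x * real n\<rceil>)
        \<le> expectation (\<lambda>\<omega>. V \<omega> n \<lceil>y * real n\<rceil>) + (\<bar>x - y\<bar> * real n + 1)"
        using expectation_V_lipschitz[of n "\<lceil>x * real n\<rceil>" "\<lceil>y * real n\<rceil>"] by linarith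
      then show ?thesis using that by (simp add: field_simps)
    qed
    then show "\<exists>N. \<forall>n\<ge>N. expectation (\<lambda>\<omega>. V \<omega> n \<lceil>x * real n\<rceil>) / real n
        \<le> expectation (\<lambda>\<omega>. V \<omega> n \<lceil>y * real n\<rceil>) / real n + \<bar>x - y\<bar> + 1 / real n" by blast
  qed
  show ?thesis using *[of x y] *[of y x] by (simp add: abs_le_iff abs_minus_commute)
qed

text \<open>Of the \<open>n\<close> columns, about \<open>t n\<close> are crossed at slope
  \<open>y\<close> and the others at slope \<open>x\<close>; subadditivity of the means compares
  this with slope \<open>w\<close>.\<close>

lemma Lambda_convex: "convex_on UNIV (Lambda G)"
proof (rule convex_onI)
  fix t x y :: real assume t: "0 < t" "t < 1"
  define w where "w = (1 - t) * x + t * y"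
  define e where "e v n = expectation (\<lambda>\<omega>. V \<omega> n \<lceil>v * real n\<rceil>)" for v n
  have e: "(\<lambda>n. e v n / real n) \<longlonglongrightarrow> Lambda G v" for v
    unfolding e_def by (rule expectation_tendsto_Lambda)
  have e0: "e v 0 = 0" for v by (simp add: e_def)
  \<comment> \<open>A share \<open>r\<close> of the columns contributes the share \<open>r\<close>
    of the limit.\<close>
  have part: "(\<lambda>n. e v (k n) / real n) \<longlonglongrightarrow> r * Lambda G v"
    if k: "\<And>n. \<bar>real (k n) - r * real n\<bar> \<le> 1" and "r > 0" for k r v
  proof -
    have kn: "(\<lambda>n. real (k n) / real n) \<longlonglongrightarrow> r"
    proof (rule tendsto_perturb[of "\<lambda>n. r * real n"])
      show "(\<lambda>n. r * real n / real n) \<longlonglongrightarrow> r"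
        by (rule tendsto_eventually) (auto simp: eventually_sequentially intro!: exI[of _ 1])
    qed (rule k)
    have "filterlim (\<lambda>n. r * real n - 1) at_top sequentially"
      using \<open>r > 0\<close> by real_asymp
    then have "filterlim (\<lambda>n. real (k n)) at_top sequentially"
      by (rule filterlim_at_top_mono) (use k in \<open>auto simp: abs_le_iff algebra_simps intro!: always_eventually\<close>)
    then have "filterlim k at_top sequentially" by (simp add: filterlim_real_sequentially filterlim_sequentially_iff_filterlim_real)
    from tendsto_mult[OF kn filterlim_compose[OF e this]]
    have "(\<lambda>n. real (k n) / real n * (e v (k n) / real (k n))) \<longlonglongrightarrow> r * Lambda G v" .
    \<comment> \<open>For \<open>k n = 0\<close> the right side vanishes by \<open>e0\<close>:
      reaching height 0 without crossing a column is free.\<close>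
    moreover have "real (k n) / real n * (e v (k n) / real (k n)) = e v (k n) / real n" for n
      using e0 by (cases "k n = 0") auto
    ultimately show ?thesis by simp
  qed
  define k where "k n = nat \<lfloor>t * real n\<rfloor>" for n
  have kt: "real (k n) \<le> t * real n" "t * real n - 1 \<le> real (k n)" for n
    using t by (simp_all add: k_def)
  have kn: "k n \<le> n" for n
  proof -
    have "t * real n \<le> real n" using t by (simp add: mult_left_le_one_le)
    then show ?thesis using kt(1)[of n] by linarith
  qed
  \<comment> \<open>The summand |x - y| pays for rounding \<open>t n\<close> down to
    \<open>k n\<close>, and 3 for the three ceilings.\<close>
  define K where "K = \<bar>x - y\<bar> + 3"
  have "(1 - t) * Lambda G x + t * Lambda G y + 0 \<ge> Lambda G w"
  proof (rule LIMSEQ_le[OF e])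
    show "(\<lambda>n. e x (n - k n) / real n + e y (k n) / real n + K * (1 / real n))
        \<longlonglongrightarrow> (1 - t) * Lambda G x + t * Lambda G y + 0"
    proof (intro tendsto_add part)
      show "(\<lambda>n. K * (1 / real n)) \<longlonglongrightarrow> 0" using tendsto_mult[OF tendsto_const lim_1_over_n, of K] by simp
      show "\<bar>real (n - k n) - (1 - t) * real n\<bar> \<le> 1" for n
        using kt[of n] kn[of n] by (simp add: of_nat_diff algebra_simps abs_le_iff)
      show "\<bar>real (k n) - t * real n\<bar> \<le> 1" for n using kt[of n] by (simp add: abs_le_iff)
    qed (use t in auto)
    have "e w n \<le> e x (n - k n) + e y (k n) + K" for n
    proof -
      define l where "l = n - k n"
      have l: "real l = real n - real (k n)" "l + k n = n" using kn[of n] by (auto simp: l_def)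
      define p where "p = x * real l"
      define q where "q = y * real (k n)"
      have "w * real n - (p + q) = (x - y) * (real (k n) - t * real n)"
        by (simp add: w_def p_def q_def l algebra_simps)
      moreover have "\<bar>(x - y) * (real (k n) - t * real n)\<bar> \<le> \<bar>x - y\<bar> * 1"
        unfolding abs_mult using kt[of n] by (intro mult_left_mono) (auto simp: abs_le_iff)
      ultimately have "\<bar>w * real n - (p + q)\<bar> \<le> \<bar>x - y\<bar>" by simp
      then have "real_of_int \<bar>\<lceil>w * real n\<rceil> - (\<lceil>p\<rceil> + \<lceil>q\<rceil>)\<bar> \<le> K"
        using ceiling_correct[of "w * real n"] ceiling_correct[of p] ceiling_correct[of q]
        unfolding K_def of_int_abs of_int_diff of_int_add by linarith
      then show ?thesis
        using expectation_V_lipschitz[of n "\<lceil>w * real n\<rceil>" "\<lceil>p\<rceil> + \<lceil>q\<rceil>"]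
          expectation_V_subadditive[of l "k n" "\<lceil>p\<rceil>" "\<lceil>q\<rceil>"] l(2)
        by (simp add: e_def p_def q_def l_def)
    qed
    then have "e w n / real n \<le> (e x (n - k n) + e y (k n) + K) / real n" for n
      by (simp add: divide_right_mono)
    then show "\<exists>N. \<forall>n\<ge>N. e w n / real n \<le> e x (n - k n) / real n + e y (k n) / real n + K * (1 / real n)"
      by (simp add: add_divide_distrib)
  qed
  then show "Lambda G ((1 - t) *\<^sub>R x + t *\<^sub>R y) \<le> (1 - t) * Lambda G x + t * Lambda G y"
    by (simp add: w_def)
qed simp

text \<open>The tilted environment has the original law, hence the same limits, and by
  \<open>tilt_approx\<close> the moved endpoint stays within bounded distance of the line of slope v
  + \<sigma>/q.\<close>

lemma AE_tilt_tendsto_Lambda: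
  assumes "s < q"
  shows "AE \<omega> in E. (\<lambda>n. V (tilt_env \<sigma> q s \<omega>) n (\<lceil>v * real n\<rceil> + tilt \<sigma> q s (Suc n)) / real n)
     \<longlonglongrightarrow> Lambda G (v + real_of_int \<sigma> / real q)"
proof -
  let ?u = "v + real_of_int \<sigma> / real q"
  have "inj (\<lambda>z::point. (fst z, snd z - tilt \<sigma> q s (Suc (nat (fst z)))))"
    by (auto simp: inj_def prod_eq_iff)
  from AE_reindex[OF this AE_tendsto_Lambda[of ?u]]
  have "AE \<omega> in E. (\<lambda>n. V (tilt_env \<sigma> q s \<omega>) n \<lceil>?u * real n\<rceil> / real n) \<longlonglongrightarrow> Lambda G ?u"
    by (simp add: tilt_env_def)
  then show ?thesis
  proof eventually_elim
    case (elim \<omega>)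
    have "\<bar>real_of_int \<lceil>?u * real n\<rceil> - real_of_int (\<lceil>v * real n\<rceil> + tilt \<sigma> q s (Suc n))\<bar> \<le> \<bar>real_of_int \<sigma>\<bar> + 2" for n
    proof -
      have "?u * real n = v * real n + real_of_int \<sigma> * real n / real q" by (simp add: distrib_right)
      then show ?thesis using tilt_approx[OF assms, of \<sigma> n] by linarith
    qed
    from tendsto_V_perturb[OF elim this] show ?case .
  qed
qed

text \<open>\<open>sum_V_tilt_le\<close> is divided by \<open>n\<close>; all \<open>q\<close> phases
  share the same limit. The estimate is deterministic on an event of full measure, so it covers
  every rule \<gamma> that selects good geodesics.\<close>

lemma AE_slope_le_liminf:
  fixes \<gamma> :: "nat \<Rightarrow> env \<Rightarrow> point list"
  assumes \<gamma>: "\<forall>n \<omega>. (\<exists>p. good_geod \<omega> p n \<lceil>v * real n\<rceil>) \<longrightarrow> good_geod \<omega> (\<gamma> n \<omega>) n \<lceil>v * real n\<rceil>"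
    and "0 < q"
  defines "f \<equiv> \<lambda>\<omega> n. fpio (\<gamma> n \<omega>) n \<lceil>v * real n\<rceil>"
  shows "AE \<omega> in E. ereal (real q * (Lambda G (v + real_of_int \<sigma> / real q) - Lambda G v))
     \<le> liminf (\<lambda>n. ereal (real_of_int (\<Sum>k\<le>n. \<bar>f \<omega> n (Suc k) - f \<omega> n k + \<sigma>\<bar> - \<bar>f \<omega> n (Suc k) - f \<omega> n k\<bar>) / real n))"
proof -
  have "AE \<omega> in E. \<forall>s\<in>{..<q}. (\<lambda>n. V (tilt_env \<sigma> q s \<omega>) n (\<lceil>v * real n\<rceil> + tilt \<sigma> q s (Suc n)) / real n)
     \<longlonglongrightarrow> Lambda G (v + real_of_int \<sigma> / real q)"
    by (intro AE_finite_allI AE_tilt_tendsto_Lambda) auto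
  then show ?thesis using AE_nonneg AE_tendsto_Lambda[of v]
  proof eventually_elim
    case (elim \<omega>)
    let ?m = "\<lambda>n. \<lceil>v * real n\<rceil>"
    define S where "S n = real_of_int (\<Sum>k\<le>n. \<bar>f \<omega> n (Suc k) - f \<omega> n k + \<sigma>\<bar> - \<bar>f \<omega> n (Suc k) - f \<omega> n k\<bar>)" for n
    define D where "D n = (\<Sum>s<q. V (tilt_env \<sigma> q s \<omega>) n (?m n + tilt \<sigma> q s (Suc n)) / real n) - real q * (V \<omega> n (?m n) / real n)" for n
    have D: "D \<longlonglongrightarrow> (\<Sum>s<q. Lambda G (v + real_of_int \<sigma> / real q)) - real q * Lambda G v"
      unfolding D_def using elim by (intro tendsto_diff tendsto_sum tendsto_mult tendsto_const) auto
    have le: "D n \<le> S n / real n" for n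
    proof -
      have "good_geod \<omega> (\<gamma> n \<omega>) n (?m n)" using \<gamma> good_geod_exists[OF elim(2)] by blast
      then have g: "is_path (\<gamma> n \<omega>) (0, 0) (int n, ?m n)" "semi_directed (\<gamma> n \<omega>)"
        "passage \<omega> (\<gamma> n \<omega>) = V \<omega> n (?m n)"
        using T_eq_V[OF elim(2)] by (auto simp: good_geod_def geodesic_def)
      have "(\<Sum>s<q. V (tilt_env \<sigma> q s \<omega>) n (?m n + tilt \<sigma> q s (Suc n))) - real q * V \<omega> n (?m n) \<le> S n"
        using sum_V_tilt_le[OF g(1,2) elim(2) \<open>0 < q\<close>, of \<sigma>] unfolding S_def f_def g(3) by simp
      from divide_right_mono[OF this, of "real n"] show ?thesis
        unfolding D_def by (simp add: diff_divide_distrib sum_divide_distrib)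
    qed
    have "ereal (real q * (Lambda G (v + real_of_int \<sigma> / real q) - Lambda G v)) = liminf (\<lambda>n. ereal (D n))"
      using D by (intro lim_imp_Liminf[symmetric]) (simp_all add: right_diff_distrib)
    also have "\<dots> \<le> liminf (\<lambda>n. ereal (S n / real n))"
      using le by (intro Liminf_mono always_eventually) simp
    finally show ?case unfolding S_def .
  qed
qed

end

section \<open>Letting the tilt tend to zero\<close>

theorem theorem2p7:
  fixes G :: "real measure" and v :: real
    and \<gamma> :: "nat \<Rightarrow> env \<Rightarrow> point list"
  assumes "prob_space G" and "sets G = sets borel" and "measure G {0..} = 1"
    and "nondeterministic G" and "v \<ge> 0"
    and "\<And>n \<omega>. (\<exists>p. good_geod \<omega> p n \<lceil>v * real n\<rceil>) \<Longrightarrow> good_geod \<omega> (\<gamma> n \<omega>) n \<lceil>v * real n\<rceil>"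
  shows "AE \<omega> in env_measure G.
     ereal (dplus (Lambda G) v) \<le> liminf (\<lambda>n. ereal
        ((real (Ucount (\<gamma> n \<omega>) n \<lceil>v * real n\<rceil>) + real (Rcount (\<gamma> n \<omega>) n \<lceil>v * real n\<rceil>)
          - real (Dcount (\<gamma> n \<omega>) n \<lceil>v * real n\<rceil>)) / real n))
   \<and> ereal (dminus (Lambda G) v) \<ge> limsup (\<lambda>n. ereal
        ((real (Ucount (\<gamma> n \<omega>) n \<lceil>v * real n\<rceil>) - real (Rcount (\<gamma> n \<omega>) n \<lceil>v * real n\<rceil>)
          - real (Dcount (\<gamma> n \<omega>) n \<lceil>v * real n\<rceil>)) / real n))"
proof -
  interpret weight_law G using assms(1-3) by (rule weight_law.intro)
  define U where "U \<omega> n = real (Ucount (\<gamma> n \<omega>) n \<lceil>v * real n\<rceil>)" for \<omega> n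
  define R where "R \<omega> n = real (Rcount (\<gamma> n \<omega>) n \<lceil>v * real n\<rceil>)" for \<omega> n
  define D where "D \<omega> n = real (Dcount (\<gamma> n \<omega>) n \<lceil>v * real n\<rceil>)" for \<omega> n
  have "\<forall>n \<omega>. (\<exists>p. good_geod \<omega> p n \<lceil>v * real n\<rceil>) \<longrightarrow> good_geod \<omega> (\<gamma> n \<omega>) n \<lceil>v * real n\<rceil>"
    using assms(6) by blast
  note slope = AE_slope_le_liminf[OF this]
  \<comment> \<open>Only countably many slopes occur, so the exceptional sets can be united.
    \<open>Suc q\<close> keeps the number of phases positive.\<close>
  have pos: "AE \<omega> in E. \<forall>q. ereal (real (Suc q) * (Lambda G (v + 1 / real (Suc q)) - Lambda G v))
      \<le> liminf (\<lambda>n. ereal ((U \<omega> n + R \<omega> n - D \<omega> n) / real n))"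
    unfolding AE_all_countable
  proof
    fix q
    show "AE \<omega> in E. ereal (real (Suc q) * (Lambda G (v + 1 / real (Suc q)) - Lambda G v))
      \<le> liminf (\<lambda>n. ereal ((U \<omega> n + R \<omega> n - D \<omega> n) / real n))"
      using slope[of "Suc q" 1] unfolding sum_tilt_counts(1) U_def R_def D_def by simp
  qed
  \<comment> \<open>Tilting downwards bounds the negated count from below; the sign stays inside the
    liminf and turns it into a limsup at the end.\<close>
  have neg: "AE \<omega> in E. \<forall>q. ereal (real (Suc q) * (Lambda G (v - 1 / real (Suc q)) - Lambda G v))
      \<le> liminf (\<lambda>n. - ereal ((U \<omega> n - R \<omega> n - D \<omega> n) / real n))"
    unfolding AE_all_countable
  proof
    fix q
    show "AE \<omega> in E. ereal (real (Suc q) * (Lambda G (v - 1 / real (Suc q)) - Lambda G v))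
      \<le> liminf (\<lambda>n. - ereal ((U \<omega> n - R \<omega> n - D \<omega> n) / real n))"
      using slope[of "Suc q" "-1", OF zero_less_Suc]
      unfolding sum_tilt_counts(2) U_def R_def D_def uminus_ereal.simps minus_divide_left by simp
  qed
  have "filterlim (\<lambda>q. v + 1 / real (Suc q)) (at_right v) sequentially"
    by real_asymp
  from filterlim_compose[OF slope_tendsto_dplus[OF Lambda_convex Lambda_lipschitz] this]
  have dplus: "(\<lambda>q. real (Suc q) * (Lambda G (v + 1 / real (Suc q)) - Lambda G v)) \<longlonglongrightarrow> dplus (Lambda G) v"
    by (simp add: mult.commute)
  have "filterlim (\<lambda>q. v - 1 / real (Suc q)) (at_left v) sequentially"
    by real_asymp
  \<comment> \<open>At w = v - 1/(q + 1) the scaled increment is minus the left difference quotient,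
    hence the change of sign.\<close>
  from tendsto_minus[OF filterlim_compose[OF slope_tendsto_dminus[OF Lambda_convex Lambda_lipschitz] this]]
  have dminus: "(\<lambda>q. real (Suc q) * (Lambda G (v - 1 / real (Suc q)) - Lambda G v)) \<longlonglongrightarrow> - dminus (Lambda G) v"
    by (simp add: algebra_simps)
  show ?thesis unfolding U_def[symmetric] R_def[symmetric] D_def[symmetric]
    using pos neg
  proof eventually_elim
    case (elim \<omega>)
    have "ereal (dplus (Lambda G) v) \<le> liminf (\<lambda>n. ereal ((U \<omega> n + R \<omega> n - D \<omega> n) / real n))"
      by (rule LIMSEQ_le_const2[OF tendsto_ereal[OF dplus]]) (use elim(1) in auto)
    moreover have "ereal (- dminus (Lambda G) v) \<le> liminf (\<lambda>n. - ereal ((U \<omega> n - R \<omega> n - D \<omega> n) / real n))"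
      by (rule LIMSEQ_le_const2[OF tendsto_ereal[OF dminus]]) (use elim(2) in auto)
    then have "- ereal (dminus (Lambda G) v) \<le> - limsup (\<lambda>n. ereal ((U \<omega> n - R \<omega> n - D \<omega> n) / real n))"
      unfolding ereal_Liminf_uminus by simp
    then have "limsup (\<lambda>n. ereal ((U \<omega> n - R \<omega> n - D \<omega> n) / real n)) \<le> ereal (dminus (Lambda G) v)"
      by (simp only: ereal_minus_le_minus)
    ultimately show ?case by blast
  qed
qed

end
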